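(* Let $q$ be an odd prime power, let $C\in\operatorname{Mat}_2(\mathbb F_q)$ be cyclic, put $\tau=\operatorname{tr}(C)$, $\nu=\det(C)$, $\Delta=\tau^2-4\nu$, and let the $K_i$ be independent and uniformly distributed on $\operatorname{Orb}(C)$. (1) Suppose $\tau\ne0$ and $\Delta\ne0$. If $C$ is split, then $$\Pr[K_1,\ldots,K_4\text{ are affinely saturated}]=\frac{q-1}{q^2(q+1)^3}\bigl(q^4+3q^3-7q^2+11q-10\bigr).$$ If $C$ is nonsplit, then $$\Pr[K_1,\ldots,K_4\text{ are affinely saturated}]=\frac{(q-2)(q+1)(q^2-2q-1)}{q^2(q-1)^2}.$$ (2) Suppose $\tau=0$ and $\nu\neq0$. If $C$ is split, then $$\Pr[K_1,K_2,K_3\text{ are linearly saturated}]=\frac{(q-1)(q^3+2q^2-4q-1)}{q^2(q+1)^2}.$$ If $C$ is nonsplit, then $$\Pr[K_1,K_2,K_3\text{ are linearly saturated}]=\frac{(q+1)(q^2-3q+1)}{q^2(q-1)}.$$ (3) If $C$ is nonzero nilpotent, then $$\Pr[K_1,K_2,K_3\text{ are linearly saturated}]=\frac{q(q-1)}{(q+1)^2}.$$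
   Context: A matrix $C\in\operatorname{Mat}_2(\mathbb F_q)$ is cyclic if there exists $v\in\mathbb F_q^2$ such that $(v,Cv)$ is a basis of $\mathbb F_q^2$. $\operatorname{Orb}(C)=\{PCP^{-1}:P\in\operatorname{GL}_2(\mathbb F_q)\}$ and $\mathfrak{sl}_2(\mathbb F_q)$ is the space of trace-zero $2\times 2$ matrices. If $\Delta\neq0$, $C$ is regular semisimple; it is called split if its characteristic polynomial splits over $\mathbb F_q$ (equivalently $\Delta$ is a square in $\mathbb F_q$), and nonsplit otherwise. A family $K_1,\dots,K_m\in\operatorname{Orb}(C)$ is affinely saturated if $\operatorname{span}\{K_i-K_1:i=2,\ldots,m\}=\mathfrak{sl}_2(\mathbb F_q)$; if $\operatorname{tr}(C)=0$ it is linearly saturated if $\operatorname{span}\{K_1,\ldots,K_m\}=\mathfrak{sl}_2(\mathbb F_q)$. *)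

theory Defs
  imports "HOL-Probability.Probability" "HOL-Computational_Algebra.Polynomial"
begin

text \<open>
  The field with \<open>q\<close> elements is an arbitrary type of class \<^class>\<open>field\<close> and \<^class>\<open>finite\<close> with
  \<open>CARD('a) = q\<close>. Caution: \<open>*\<close> and \<open>^\<close> on \<open>'a^'n^'n\<close> act componentwise, so matrix products are
  always written with \<open>**\<close>.
\<close>

definition scale_matrix :: "'a::field \<Rightarrow> 'a^'n^'m \<Rightarrow> 'a^'n^'m" where
  "scale_matrix c A = (\<chi> i j. c * A $ i $ j)"

global_interpretation mat_vs: vector_space "scale_matrix :: 'a::field \<Rightarrow> 'a^'n^'m \<Rightarrow> 'a^'n^'m"
  by unfold_locales (simp_all add: scale_matrix_def vec_eq_iff algebra_simps)

definition cyclic_mat :: "'a::field^2^2 \<Rightarrow> bool" where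
  "cyclic_mat C \<longleftrightarrow>
     (\<exists>v. v \<noteq> C *v v \<and> vec.independent {v, C *v v} \<and> vec.span {v, C *v v} = UNIV)"

definition Orb :: "'a::field^2^2 \<Rightarrow> ('a^2^2) set" where
  "Orb C = {P ** C ** matrix_inv P | P. invertible P}"

definition sl2 :: "('a::field^2^2) set" where
  "sl2 = {A. trace A = 0}"

definition disc :: "'a::field^2^2 \<Rightarrow> 'a" where
  "disc C = (trace C)^2 - 4 * det C"

definition charpoly :: "'a::field^2^2 \<Rightarrow> 'a poly" where
  "charpoly C = det (mat [:0, 1:] - map_matrix (\<lambda>c. [:c:]) C)"

definition poly_splits :: "'a::field poly \<Rightarrow> bool" where
  "poly_splits p \<longleftrightarrow> (\<exists>c as. p = smult c (\<Prod>a\<leftarrow>as. [:- a, 1:]))"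

definition regular_semisimple :: "'a::field^2^2 \<Rightarrow> bool" where
  "regular_semisimple C \<longleftrightarrow> disc C \<noteq> 0"

definition split_mat :: "'a::field^2^2 \<Rightarrow> bool" where
  "split_mat C \<longleftrightarrow> regular_semisimple C \<and> poly_splits (charpoly C)"

definition nonsplit_mat :: "'a::field^2^2 \<Rightarrow> bool" where
  "nonsplit_mat C \<longleftrightarrow> regular_semisimple C \<and> \<not> poly_splits (charpoly C)"

definition nilpotent_mat :: "'a::field^2^2 \<Rightarrow> bool" where
  "nilpotent_mat C \<longleftrightarrow> (\<exists>k. (((**) C) ^^ k) (mat 1) = 0)"

text \<open>Families \<open>K\<^sub>1, \<dots>, K\<^sub>m\<close> are functions on \<^typ>\<open>nat\<close> of which only the values on \<open>{1..m}\<close> matter.\<close>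

definition affinely_saturated :: "nat \<Rightarrow> (nat \<Rightarrow> 'a::field^2^2) \<Rightarrow> bool" where
  "affinely_saturated m K \<longleftrightarrow> mat_vs.span {K i - K 1 | i. i \<in> {2..m}} = sl2"

definition linearly_saturated :: "nat \<Rightarrow> (nat \<Rightarrow> 'a::field^2^2) \<Rightarrow> bool" where
  "linearly_saturated m K \<longleftrightarrow> mat_vs.span {K i | i. i \<in> {1..m}} = sl2"

text \<open>\<open>S\<close> is meant to be finite and nonempty, as required by \<^const>\<open>pmf_of_set\<close>.\<close>

definition iid_uniform :: "'w measure \<Rightarrow> 'b set \<Rightarrow> (nat \<Rightarrow> 'w \<Rightarrow> 'b) \<Rightarrow> nat set \<Rightarrow> bool" where
  "iid_uniform M S K I \<longleftrightarrow>
     prob_space.indep_vars M (\<lambda>_. count_space UNIV) K I \<and>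
     (\<forall>i\<in>I. distr M (count_space UNIV) (K i) = measure_pmf (pmf_of_set S))"

end

theory Submission
  imports Defs
begin

text \<open>
  Put \<open>h = \<tau> / 2\<close> and \<open>d = \<Delta> / 4\<close>. A matrix of trace \<open>\<tau>\<close> is \<open>h \<cdot> 1 + Y\<close> with \<open>Y\<close> traceless, and
  if \<open>Y\<close> has first row \<open>(a, b)\<close> and second row \<open>(c, -a)\<close>, then its determinant is \<open>h\<^sup>2 - (a\<^sup>2 + b c)\<close>.
  Non-scalar \<open>2 \<times> 2\<close> matrices with equal trace and determinant are conjugate, because all of them are
  similar to the same companion matrix. Hence \<open>Orb C\<close> is the set of nonzero points of the quadric
  \<open>a\<^sup>2 + b c = d\<close> in the three-dimensional space over the field (\<open>Orb_eq_quadric\<close>). The scalar part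
  cancels in differences and is absent for \<open>\<tau> = 0\<close>. So the task is to count the triples of points
  that are a basis, and the quadruples of points that are affinely independent.

  Let \<open>k\<close> be the number of linear functionals that vanish on three given vectors. It is \<open>1\<close>, \<open>q\<close>,
  \<open>q\<^sup>2\<close> or \<open>q\<^sup>3\<close> according to their rank, so
  \<open>k = 1 + (q - 1) [rank \<le> 2] + (q\<^sup>2 - q) [rank \<le> 1] + (q\<^sup>3 - q\<^sup>2) [rank = 0]\<close>
  (\<open>annihilator_rank_expansion\<close>). Summed over all families, this expresses the number of
  non-spanning families by the sum of \<open>k\<close> and the numbers of families of rank at most \<open>1\<close> and \<open>0\<close>.

  Exchanging the order of summation, the sum of \<open>k\<close> is the sum of \<open>s(n, 0)\<^sup>3\<close> over all \<open>n\<close> in the linear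
  case and the sum of \<open>s(n, t)\<^sup>4\<close> over all \<open>n\<close> and \<open>t\<close> in the affine case, where \<open>s(n, t)\<close> is the number
  of points of the quadric with \<open>n \<cdot> x = t\<close>. These sections are conics. Sums of the quadratic
  character over the values of a quadratic polynomial give their sizes (\<open>card_section\<close>), which depend
  on \<open>n \<noteq> 0\<close> only through the dual form \<open>D = n\<^sub>1\<^sup>2 + 4 n\<^sub>2 n\<^sub>3\<close>, and \<open>D\<close> takes each value on a dual quadric
  of known size (\<open>sum_over_normals\<close>).

  The families of rank at most \<open>1\<close> are collinear. In the linear case they come from the two points
  \<open>u\<close> and \<open>-u\<close> on a line through the origin, or from the \<open>q - 1\<close> points of a generator of the cone.
  In the affine case a line through two points of the quadric either has no further point of it or
  lies on it (\<open>card_quadric_secant\<close>), and the lines of the latter kind through a point are again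
  counted by a plane section, now of the cone (\<open>card_quadric_ruling\<close>). Finally, independence makes all families equally likely
  (\<open>iid_uniform_prob\<close>), and the stated fractions follow by polynomial identities.
\<close>

section \<open>The quadratic character\<close>

text \<open>
  Translation by \<open>1\<close> permutes the field, so \<open>q \<cdot> 1 = 0\<close>; together with \<open>2 = 0\<close> and \<open>q\<close> odd this would
  give \<open>1 = 0\<close>.
\<close>

lemma odd_card_two_neq_0:
  assumes "odd CARD('a::{field,finite})"
  shows "(2::'a) \<noteq> 0"
proof
  assume two: "(2::'a) = 0"
  have "even (card (UNIV :: 'a set))"
  proof -
    have "(of_nat CARD('a) :: 'a) = 0"
    proof -
      have "(\<Sum>x\<in>(UNIV::'a set). x) = (\<Sum>x\<in>UNIV. x + 1)"
        by (rule sum.reindex_bij_witness[of _ "\<lambda>x. x + 1" "\<lambda>x. x - 1"]) auto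
      then show ?thesis by (simp add: sum.distrib)
    qed
    then show ?thesis using two
      by (metis assms evenE odd_two_times_div_two_succ of_nat_add of_nat_mult of_nat_1 of_nat_numeral mult_zero_left add_0 zero_neq_one)
  qed
  with assms show False by simp
qed

lemma odd_card_four_neq_0:
  assumes "odd CARD('a::{field,finite})"
  shows "(4::'a) \<noteq> 0"
  using odd_card_two_neq_0[OF assms]
  by (metis mult_eq_0_iff numeral_times_numeral semiring_norm(13) semiring_norm(11))

text \<open>
  The quadratic character, with values in the reals since it enters numbers of points as a real
  coefficient.
\<close>

definition qchar :: "'a::field \<Rightarrow> real" where
  "qchar e = (if e = 0 then 0 else if \<exists>x. e = x^2 then 1 else -1)"

lemma qchar_0 [simp]: "qchar 0 = 0"
  by (simp add: qchar_def)

lemma qchar_cases: "qchar e = 0 \<or> qchar e = 1 \<or> qchar e = -1"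
  by (simp add: qchar_def)

lemma qchar_eq_0_iff [simp]: "qchar e = 0 \<longleftrightarrow> e = 0"
  by (simp add: qchar_def)

lemma sum_UNIV_cong: "(\<And>x. f x = g x) \<Longrightarrow> sum f UNIV = sum g UNIV"
  by (rule sum.cong) auto

text \<open>
  This is what makes the character useful: the number of solutions of a quadratic condition becomes
  a character value, and numbers of points become character sums.
\<close>

lemma count_square_roots:
  assumes odd: "odd CARD('a::{field,finite})"
  shows "(\<Sum>x\<in>(UNIV::'a set). of_bool (x^2 = e)) = 1 + qchar e"
proof -
  note two = odd_card_two_neq_0[OF odd]
  have c: "(\<Sum>x\<in>(UNIV::'a set). of_bool (x^2 = e)) = real (card {x::'a. x^2 = e})"
    by (simp add: sum.If_cases of_bool_def)
  consider "e = 0" | y where "y \<noteq> 0" "e = y^2" | "e \<noteq> 0" "\<not> (\<exists>x. e = x^2)"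
    by (metis power2_eq_square mult_zero_left)
  then show ?thesis
  proof cases
    case 1
    then have "{x::'a. x^2 = e} = {0}" by auto
    with 1 c show ?thesis by simp
  next
    case (2 y)
    have "y \<noteq> - y"
    proof
      assume "y = - y"
      then have "2 * y = 0" by (metis add.right_inverse mult_2)
      then show False using two 2 by simp
    qed
    moreover have "{x::'a. x^2 = e} = {y, -y}"
      using 2 by (auto simp: power2_eq_iff)
    ultimately show ?thesis using c 2 by (auto simp: qchar_def)
  next
    case 3
    then have "{x::'a. x^2 = e} = {}" by auto
    with c 3 show ?thesis by (simp add: qchar_def)
  qed
qed

text \<open>
  Substituting \<open>y = c\<^sup>2\<close>: each \<open>y\<close> is hit \<open>1 + qchar y\<close> times.
\<close>

lemma sum_power2:
  fixes g :: "'a::{field,finite} \<Rightarrow> real"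
  assumes odd: "odd CARD('a)"
  shows "(\<Sum>c\<in>UNIV. g (c^2)) = (\<Sum>y\<in>UNIV. (1 + qchar y) * g y)"
proof -
  have "(\<Sum>c\<in>UNIV. g (c^2)) = (\<Sum>c\<in>(UNIV::'a set). \<Sum>y\<in>UNIV. of_bool (c^2 = y) * g y)"
    by (simp add: of_bool_def if_distrib[of "\<lambda>x. x * _"] cong: if_cong)
  also have "\<dots> = (\<Sum>y\<in>UNIV. (\<Sum>c\<in>(UNIV::'a set). of_bool (c^2 = y)) * g y)"
    by (subst sum.swap) (simp add: sum_distrib_right)
  finally show ?thesis by (simp only: count_square_roots[OF odd])
qed

lemma sum_qchar:
  assumes odd: "odd CARD('a::{field,finite})"
  shows "(\<Sum>y\<in>(UNIV::'a set). qchar y) = 0"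
  using sum_power2[OF odd, of "\<lambda>_. 1"] by (simp add: sum.distrib)

text \<open>
  The only case with content is that of two non-squares. The character has sum \<open>0\<close>, so there are as
  many nonzero squares as non-squares. Multiplication by a non-square maps squares injectively to
  non-squares, hence onto them, and so non-squares to squares.
\<close>

lemma qchar_mult:
  fixes a b :: "'a::{field,finite}"
  assumes odd: "odd CARD('a)"
  shows "qchar (a * b) = qchar a * qchar b"
proof -
  define SQ NS :: "'a set" where "SQ = {x. x \<noteq> 0 \<and> (\<exists>y. x = y^2)}"
    and "NS = {x. x \<noteq> 0 \<and> \<not> (\<exists>y. x = y^2)}"
  have "(\<Sum>y\<in>(UNIV::'a set). qchar y) = (\<Sum>y\<in>UNIV. of_bool (y \<in> SQ) - of_bool (y \<in> NS))"
    by (rule sum_UNIV_cong) (auto simp: qchar_def SQ_def NS_def)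
  then have "real (card SQ) = real (card NS)"
    using sum_qchar[OF odd] by (simp add: sum_subtractf sum.If_cases of_bool_def)
  then have card: "card SQ = card NS" by simp
  have mixed: "a * b \<in> NS" if "a \<in> NS" "b \<in> SQ" for a b
  proof -
    from that obtain y where y: "b = y^2" "y \<noteq> 0" by (auto simp: SQ_def)
    have False if "a * y^2 = z^2" for z
    proof -
      have "a = (z / y)^2" using that y by (simp add: power_divide field_simps)
      then show False using \<open>a \<in> NS\<close> by (auto simp: NS_def)
    qed
    then show ?thesis using that y by (auto simp: NS_def)
  qed
  have both: "a * b \<in> SQ" if "a \<in> NS" "b \<in> NS" for a b
  proof -
    have "inj_on ((*) a) SQ" using that by (auto simp: inj_on_def NS_def)
    then have "card ((*) a ` SQ) = card NS" using card by (simp add: card_image)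
    moreover have "(*) a ` SQ \<subseteq> NS" using mixed that by auto
    ultimately have "(*) a ` SQ = NS" by (intro card_subset_eq) auto
    then have "b \<in> (*) a ` SQ" using that by simp
    then obtain s where "s \<in> SQ" "b = a * s" by blast
    then obtain y where "s = y^2" by (auto simp: SQ_def)
    then have "a * b = (a * y)^2" using \<open>b = a * s\<close> by (simp add: power2_eq_square)
    then show ?thesis using that by (auto simp: SQ_def NS_def)
  qed
  have sq: "a * b \<in> SQ" if "a \<in> SQ" "b \<in> SQ" for a b
    using that by (auto simp: SQ_def power_mult_distrib[symmetric])
  have cases: "x = 0 \<or> x \<in> SQ \<or> x \<in> NS" for x by (auto simp: SQ_def NS_def)
  have val: "x \<in> SQ \<Longrightarrow> qchar x = 1" "x \<in> NS \<Longrightarrow> qchar x = -1" for x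
    by (auto simp: SQ_def NS_def qchar_def)
  have mixed': "a * b \<in> NS" if "a \<in> SQ" "b \<in> NS" for a b
    using mixed[OF that(2,1)] by (simp add: mult.commute)
  show ?thesis
    using cases[of a] cases[of b] mixed mixed' both sq val by (auto; smt (verit))
qed

lemma qchar_power2: "x \<noteq> 0 \<Longrightarrow> qchar (x^2) = 1"
  by (auto simp: qchar_def)

lemma qchar_power2_mult:
  fixes x y :: "'a::{field,finite}"
  assumes "odd CARD('a)" "x \<noteq> 0"
  shows "qchar (x^2 * y) = qchar y"
  using assms by (simp add: qchar_mult qchar_power2)

text \<open>
  For \<open>u \<noteq> 0\<close> there is exactly one \<open>v\<close>; for \<open>u = 0\<close> every \<open>v\<close> works or none.
\<close>

lemma count_hyperbola:
  "(\<Sum>u\<in>(UNIV::'a::{field,finite} set). \<Sum>v\<in>UNIV. of_bool (u * v = e))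
     = real CARD('a) - 1 + real CARD('a) * of_bool (e = 0)"
proof -
  have "(\<Sum>v\<in>(UNIV::'a set). of_bool (u * v = e)) = (1::real)" if "u \<noteq> 0" for u
  proof -
    have "{v. u * v = e} = {e / u}" using that by (auto simp: field_simps)
    then show ?thesis by (simp add: of_bool_def sum.If_cases)
  qed
  moreover have "(\<Sum>u\<in>(UNIV::'a set). \<Sum>v\<in>UNIV. of_bool (u * v = e))
     = (\<Sum>v\<in>(UNIV::'a set). of_bool (0 = e)) + (\<Sum>u\<in>UNIV - {0}. \<Sum>v\<in>(UNIV::'a set). of_bool (u * v = e) :: real)"
    by (subst sum.remove[of _ 0]) auto
  ultimately show ?thesis by (auto simp: card_Diff_singleton of_nat_diff Suc_leI)
qed

text \<open>
  The sum of \<open>1 + qchar (c\<^sup>2 - e)\<close> counts the points of \<open>a\<^sup>2 = c\<^sup>2 - e\<close>, and the coordinates \<open>u = c - a\<close>,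
  \<open>v = c + a\<close> turn this curve into the hyperbola \<open>u v = e\<close>.
\<close>

lemma sum_qchar_power2_diff:
  assumes odd: "odd CARD('a::{field,finite})"
  shows "(\<Sum>c\<in>(UNIV::'a set). qchar (c^2 - e)) = real CARD('a) * of_bool (e = 0) - 1"
proof -
  note two = odd_card_two_neq_0[OF odd]
  have "(\<Sum>c\<in>(UNIV::'a set). 1 + qchar (c^2 - e))
      = (\<Sum>c\<in>UNIV. \<Sum>a\<in>(UNIV::'a set). of_bool (a^2 = c^2 - e))"
    by (simp add: count_square_roots[OF odd])
  also have "\<dots> = (\<Sum>(c,a)\<in>(UNIV::('a\<times>'a) set). of_bool (a^2 = c^2 - e))"
    by (simp only: sum.cartesian_product UNIV_Times_UNIV)
  also have "\<dots> = (\<Sum>(u,v)\<in>(UNIV::('a\<times>'a) set). of_bool (u * v = e))"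
    using two odd_card_four_neq_0[OF odd]
    by (intro sum.reindex_bij_witness[of _ "\<lambda>(u,v). ((u + v) / 2, (v - u) / 2)" "\<lambda>(c,a). (c - a, c + a)"])
      (auto simp: field_simps power2_eq_square)
  also have "\<dots> = real CARD('a) - 1 + real CARD('a) * of_bool (e = 0)"
    using count_hyperbola[of e] by (simp only: sum.cartesian_product UNIV_Times_UNIV)
  finally show ?thesis by (simp add: sum.distrib)
qed

lemma sum_qchar_shift:
  assumes odd: "odd CARD('a::{field,finite})"
  shows "(\<Sum>y\<in>(UNIV::'a set). qchar (y - e)) = 0"
proof -
  have "(\<Sum>y\<in>(UNIV::'a set). qchar (y - e)) = (\<Sum>y\<in>(UNIV::'a set). qchar y)"
    by (rule sum.reindex_bij_witness[of _ "\<lambda>x. x + e" "\<lambda>x. x - e"]) auto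
  then show ?thesis by (simp add: sum_qchar[OF odd])
qed

text \<open>
  A leading coefficient \<open>A\<close> only contributes its sign \<open>qchar A\<close>: substituting \<open>y = c\<^sup>2\<close> and then scaling
  by \<open>A\<close> leaves the correlation sum of \<open>qchar y\<close> and \<open>qchar (y - e)\<close>, multiplied by \<open>qchar A\<close>, and the case
  \<open>A = 1\<close> evaluates that sum.
\<close>

lemma sum_qchar_mult_power2_diff:
  fixes A e :: "'a::{field,finite}"
  assumes odd: "odd CARD('a)" and A: "A \<noteq> 0"
  shows "(\<Sum>c\<in>UNIV. qchar (A * c^2 - e)) = qchar A * (real CARD('a) * of_bool (e = 0) - 1)"
proof -
  let ?S = "\<Sum>y\<in>(UNIV::'a set). qchar y * qchar (y - e)"
  have qA: "qchar A * qchar A = 1" using A qchar_cases[of A] by auto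
  have "(\<Sum>c\<in>UNIV. qchar (A * c^2 - e)) = (\<Sum>y\<in>UNIV. (1 + qchar y) * qchar (A * y - e))"
    by (rule sum_power2[OF odd])
  also have "\<dots> = (\<Sum>y\<in>UNIV. (1 + qchar A * qchar y) * qchar (y - e))"
  proof (rule sum.reindex_bij_witness[of _ "\<lambda>y. y / A" "\<lambda>y. A * y"])
    fix y
    show "(1 + qchar A * qchar (A * y)) * qchar (A * y - e) = (1 + qchar y) * qchar (A * y - e)"
      using qA by (simp add: qchar_mult[OF odd] mult.assoc[symmetric])
  qed (use A in auto)
  also have "\<dots> = qchar A * ?S"
    by (simp add: distrib_right sum.distrib sum_qchar_shift[OF odd] sum_distrib_left mult.assoc)
  also have "?S = (\<Sum>y\<in>UNIV. (1 + qchar y) * qchar (y - e))"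
    by (simp add: distrib_right sum.distrib sum_qchar_shift[OF odd])
  also have "\<dots> = real CARD('a) * of_bool (e = 0) - 1"
    by (simp add: sum_power2[OF odd, of "\<lambda>y. qchar (y - e)", symmetric] sum_qchar_power2_diff[OF odd])
  finally show ?thesis .
qed

text \<open>
  Completing the square.
\<close>

lemma sum_qchar_quadratic:
  fixes A B E :: "'a::{field,finite}"
  assumes odd: "odd CARD('a)" and A: "A \<noteq> 0"
  shows "(\<Sum>c\<in>UNIV. qchar (A * c^2 + B * c + E))
    = qchar A * (real CARD('a) * of_bool (B^2 = 4 * A * E) - 1)"
proof -
  note two = odd_card_two_neq_0[OF odd]
  note four = odd_card_four_neq_0[OF odd]
  \<comment> \<open>the polynomial is \<open>A (c + h)\<^sup>2 - (A h\<^sup>2 - E)\<close>\<close>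
  define h where "h = B / (2 * A)"
  have B: "B = 2 * A * h" using two A by (simp add: h_def)
  have "(\<Sum>c\<in>UNIV. qchar (A * c^2 + B * c + E)) = (\<Sum>c\<in>UNIV. qchar (A * c^2 - (A * h^2 - E)))"
    by (rule sum.reindex_bij_witness[of _ "\<lambda>c. c - h" "\<lambda>c. c + h"])
      (auto simp: B algebra_simps power2_eq_square)
  also have "\<dots> = qchar A * (real CARD('a) * of_bool (A * h^2 - E = 0) - 1)"
    by (rule sum_qchar_mult_power2_diff[OF odd A])
  also have "A * h^2 - E = 0 \<longleftrightarrow> 4 * A * (A * h^2 - E) = 0" using four A by simp
  also have "\<dots> \<longleftrightarrow> B^2 = 4 * A * E" by (simp add: B algebra_simps power2_eq_square)
  finally show ?thesis .
qed

lemma count_quadratic_roots: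
  fixes a b c :: "'a::{field,finite}"
  assumes odd: "odd CARD('a)" and a: "a \<noteq> 0"
  shows "(\<Sum>x\<in>UNIV. of_bool (a * x^2 + b * x + c = 0)) = 1 + qchar (b^2 - 4 * a * c)"
proof -
  note two = odd_card_two_neq_0[OF odd]
  have "(\<Sum>x\<in>UNIV. of_bool (a * x^2 + b * x + c = 0))
     = (\<Sum>y\<in>UNIV. of_bool (y^2 = b^2 - 4 * a * c) :: real)"
  proof (rule sum.reindex_bij_witness[of _ "\<lambda>y. (y - b) / (2 * a)" "\<lambda>x. 2 * a * x + b"])
    fix x
    have "(2 * a * x + b)^2 - (b^2 - 4 * a * c) = 4 * a * (a * x^2 + b * x + c)"
      by (simp add: algebra_simps power2_eq_square)
    moreover have "4 * a \<noteq> 0" using odd_card_four_neq_0[OF odd] a by simp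
    ultimately have "(2 * a * x + b)^2 = b^2 - 4 * a * c \<longleftrightarrow> a * x^2 + b * x + c = 0"
      by (metis mult_eq_0_iff right_minus_eq)
    then show "of_bool ((2 * a * x + b)^2 = b^2 - 4 * a * c) = (of_bool (a * x^2 + b * x + c = 0) :: real)"
      by simp
  qed (use two a in auto)
  then show ?thesis by (simp add: count_square_roots[OF odd])
qed

section \<open>Plane sections of a quadric\<close>

text \<open>
  The negative determinant of the traceless matrix with first row \<open>(x\<^sub>1, x\<^sub>2)\<close> and second row
  \<open>(x\<^sub>3, -x\<^sub>1)\<close>.
\<close>

definition qform :: "'a::field^3 \<Rightarrow> 'a" where
  "qform x = (x$1)^2 + x$2 * x$3"

text \<open>
  Four times the form that \<open>qform\<close> induces on linear functionals; the factor avoids fractions.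
\<close>

definition dual_qform :: "'a::field^3 \<Rightarrow> 'a" where
  "dual_qform n = (n$1)^2 + 4 * n$2 * n$3"

lemma sum_vec3:
  fixes f :: "'a::finite^3 \<Rightarrow> 'b::comm_monoid_add"
  shows "(\<Sum>x\<in>UNIV. f x) = (\<Sum>a\<in>UNIV. \<Sum>b\<in>UNIV. \<Sum>c\<in>UNIV. f (\<chi> i. if i = 1 then a else if i = 2 then b else c))"
proof -
  have "(\<Sum>x\<in>UNIV. f x) = (\<Sum>(a,b,c)\<in>UNIV. f (\<chi> i. if i = 1 then a else if i = 2 then b else c))"
    by (rule sum.reindex_bij_witness[of _
          "\<lambda>(a,b,c). \<chi> i. if i = 1 then a else if i = 2 then b else c" "\<lambda>x. (x$1, x$2, x$3)"])
      (auto simp: vec_eq_iff forall_3 intro!: arg_cong[of _ _ f])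
  then show ?thesis by (simp only: sum.cartesian_product UNIV_Times_UNIV)
qed

lemma scalar_product_3: "scalar_product n x = n$1 * x$1 + n$2 * x$2 + n$3 * x$3" for x :: "'a::field^3"
  by (simp add: scalar_product_def sum_3)

lemma real_card_Collect: "real (card {x::'a::finite. P x}) = (\<Sum>x\<in>UNIV. of_bool (P x))"
  by (simp add: of_bool_def sum.If_cases)

text \<open>
  If the coefficient \<open>n2\<close> is not zero, then \<open>b\<close> can be eliminated. For each \<open>c\<close> there remains a quadratic
  equation for \<open>a\<close>, whose discriminant is a quadratic polynomial in \<open>c\<close> with leading coefficient \<open>D\<close>
  and discriminant proportional to \<open>t\<^sup>2 - D d\<close>.
\<close>

lemma count_section_oblique:
  fixes n1 n2 n3 d t :: "'a::{field,finite}"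
  assumes odd: "odd CARD('a)" and n2: "n2 \<noteq> 0"
  defines "q \<equiv> real CARD('a)" and "D \<equiv> n1^2 + 4 * n2 * n3"
  shows "(\<Sum>a\<in>UNIV. \<Sum>b\<in>UNIV. \<Sum>c\<in>UNIV. of_bool (a^2 + b * c = d \<and> n1 * a + n2 * b + n3 * c = t))
    = q - qchar D + q * (if D = 0 then qchar d else qchar D) * of_bool (D * d = t^2)"
proof -
  note four = odd_card_four_neq_0[OF odd]
  have b: "(\<Sum>b\<in>(UNIV::'a set). of_bool (a^2 + b * c = d \<and> n1 * a + n2 * b + n3 * c = t))
      = (of_bool (n2 * a^2 + (- n1 * c) * a + (c * (t - n3 * c) - n2 * d) = 0) :: real)" for a c
  proof -
    define b0 where "b0 = (t - n1 * a - n3 * c) / n2"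
    have 1: "n1 * a + n2 * b + n3 * c = t \<longleftrightarrow> b = b0" for b
      using n2 by (auto simp: b0_def field_simps)
    have "a^2 + b0 * c = d \<longleftrightarrow> n2 * (a^2 + b0 * c) = n2 * d" using n2 by simp
    also have "n2 * (a^2 + b0 * c) = n2 * a^2 + (n2 * b0) * c" by (simp add: algebra_simps)
    also have "n2 * b0 = t - n1 * a - n3 * c" using n2 by (simp add: b0_def)
    finally have 2: "a^2 + b0 * c = d \<longleftrightarrow> n2 * a^2 + (- n1 * c) * a + (c * (t - n3 * c) - n2 * d) = 0"
      by (simp add: algebra_simps)
    have "(\<Sum>b\<in>(UNIV::'a set). of_bool (a^2 + b * c = d \<and> n1 * a + n2 * b + n3 * c = t))
      = (\<Sum>b\<in>UNIV. if b = b0 then of_bool (a^2 + b0 * c = d) else (0::real))"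
      by (rule sum.cong) (auto simp: 1)
    then show ?thesis by (simp add: 2)
  qed
  have "(\<Sum>a\<in>UNIV. \<Sum>b\<in>UNIV. \<Sum>c\<in>(UNIV::'a set). of_bool (a^2 + b * c = d \<and> n1 * a + n2 * b + n3 * c = t) :: real)
    = (\<Sum>c\<in>UNIV. \<Sum>a\<in>UNIV. \<Sum>b\<in>UNIV. of_bool (a^2 + b * c = d \<and> n1 * a + n2 * b + n3 * c = t))"
    (is "?L = _")
  proof -
    have "?L = (\<Sum>a\<in>UNIV. \<Sum>c\<in>UNIV. \<Sum>b\<in>UNIV. of_bool (a^2 + b * c = d \<and> n1 * a + n2 * b + n3 * c = t))"
      by (rule sum_UNIV_cong) (rule sum.swap)
    also have "\<dots> = (\<Sum>c\<in>UNIV. \<Sum>a\<in>UNIV. \<Sum>b\<in>UNIV. of_bool (a^2 + b * c = d \<and> n1 * a + n2 * b + n3 * c = t))"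
      by (rule sum.swap)
    finally show ?thesis .
  qed
  also have "\<dots> = (\<Sum>c\<in>UNIV. \<Sum>a\<in>UNIV.
      of_bool (n2 * a^2 + (- n1 * c) * a + (c * (t - n3 * c) - n2 * d) = 0))"
    by (simp only: b)
  also have "\<dots> = (\<Sum>c\<in>UNIV. 1 + qchar ((- n1 * c)^2 - 4 * n2 * (c * (t - n3 * c) - n2 * d)))"
    by (simp only: count_quadratic_roots[OF odd n2])
  also have "\<dots> = (\<Sum>c\<in>UNIV. 1 + qchar (D * c^2 + (- 4 * n2 * t) * c + 4 * n2^2 * d))"
    by (rule sum_UNIV_cong) (simp add: D_def algebra_simps power2_eq_square)
  also have "\<dots> = q + (\<Sum>c\<in>UNIV. qchar (D * c^2 + (- 4 * n2 * t) * c + 4 * n2^2 * d))"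
    by (simp add: sum.distrib q_def)
  also have "(\<Sum>c\<in>UNIV. qchar (D * c^2 + (- 4 * n2 * t) * c + 4 * n2^2 * d))
     = - qchar D + q * (if D = 0 then qchar d else qchar D) * of_bool (D * d = t^2)"
  proof (cases "D = 0")
    case False
    have disc: "(- 4 * n2 * t)^2 - 4 * D * (4 * n2^2 * d) = (4 * n2)^2 * (t^2 - D * d)"
      by (simp add: algebra_simps power2_eq_square)
    have "4 * n2 \<noteq> 0" using n2 four by (simp only: mult_eq_0_iff simp_thms)
    then have "(4 * n2)^2 \<noteq> 0" by (rule power_not_zero)
    then have "(- 4 * n2 * t)^2 - 4 * D * (4 * n2^2 * d) = 0 \<longleftrightarrow> t^2 - D * d = 0"
      unfolding disc by (simp only: mult_eq_0_iff simp_thms)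
    then have iff: "(- 4 * n2 * t)^2 = 4 * D * (4 * n2^2 * d) \<longleftrightarrow> D * d = t^2"
      by (simp only: right_minus_eq eq_commute[of "t^2"])
    have "(\<Sum>c\<in>UNIV. qchar (D * c^2 + (- 4 * n2 * t) * c + 4 * n2^2 * d))
        = qchar D * (q * of_bool (D * d = t^2) - 1)"
      unfolding sum_qchar_quadratic[OF odd False] iff q_def ..
    also have "\<dots> = - qchar D + q * (if D = 0 then qchar d else qchar D) * of_bool (D * d = t^2)"
      using False by (simp add: right_diff_distrib)
    finally show ?thesis .
  next
    case D: True
    show ?thesis
    proof (cases "t = 0")
      case True
      have "4 * n2^2 * d = (2 * n2)^2 * d" by (simp add: algebra_simps power2_eq_square)
      moreover have "2 * n2 \<noteq> 0" using n2 odd_card_two_neq_0[OF odd] by simp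
      ultimately have "qchar (4 * n2^2 * d) = qchar d"
        using qchar_power2_mult[OF odd, of "2 * n2" d] by (simp only: simp_thms)
      then show ?thesis using True D by (simp add: q_def)
    next
      case False
      have "(\<Sum>c\<in>UNIV. qchar (D * c^2 + (- 4 * n2 * t) * c + 4 * n2^2 * d)) = (\<Sum>y\<in>(UNIV::'a set). qchar y)"
      proof (rule sum.reindex_bij_witness[of _ "\<lambda>y. (y - 4 * n2^2 * d) / (- 4 * n2 * t)"
              "\<lambda>c. (- 4 * n2 * t) * c + 4 * n2^2 * d"])
        have "- 4 * n2 * t \<noteq> 0" using False n2 four by simp
        then show "((- 4 * n2 * t) * c + 4 * n2^2 * d - 4 * n2^2 * d) / (- 4 * n2 * t) = c"
          "(- 4 * n2 * t) * ((y - 4 * n2^2 * d) / (- 4 * n2 * t)) + 4 * n2^2 * d = y" for c y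
          by (simp_all only: add_diff_cancel_right' nonzero_mult_div_cancel_left times_divide_eq_right diff_add_cancel simp_thms)
      qed (use D in simp_all)
      then show ?thesis using D False by (simp add: sum_qchar[OF odd])
    qed
  qed
  finally show ?thesis by simp
qed

text \<open>
  The section is a degenerate conic exactly if \<open>D d = t\<^sup>2\<close>. For \<open>D \<noteq> 0\<close> a degenerate section is a pair of
  crossing lines or a point, and the other sections have \<open>q - qchar D\<close> points. For \<open>D = 0\<close> the plane is
  parallel to a tangent plane of the cone \<open>qform x = 0\<close>; the section is a parabola for \<open>t \<noteq> 0\<close>, and for
  \<open>t = 0\<close> it consists of one or two parallel lines or is empty.
\<close>

lemma card_section:
  fixes n :: "'a::{field,finite}^3"
  assumes odd: "odd CARD('a)" and n: "n \<noteq> 0"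
  defines "q \<equiv> real CARD('a)" and "D \<equiv> dual_qform n"
  shows "real (card {x. qform x = d \<and> scalar_product n x = t})
    = q - qchar D + q * (if D = 0 then qchar d else qchar D) * of_bool (D * d = t^2)"
proof -
  let ?P = "\<lambda>a b c. of_bool (a^2 + b * c = d \<and> n$1 * a + n$2 * b + n$3 * c = t) :: real"
  have S: "real (card {x. qform x = d \<and> scalar_product n x = t})
    = (\<Sum>a\<in>UNIV. \<Sum>b\<in>UNIV. \<Sum>c\<in>UNIV. ?P a b c)"
    by (simp add: real_card_Collect sum_vec3 qform_def scalar_product_3 del: sum_of_bool_eq)
  consider "n$2 \<noteq> 0" | "n$3 \<noteq> 0" | "n$2 = 0" "n$3 = 0" "n$1 \<noteq> 0"
    using n by (auto simp: vec_eq_iff forall_3)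
  then show ?thesis
  proof cases
    case 1
    show ?thesis unfolding S
      by (subst count_section_oblique[OF odd 1]) (simp add: D_def dual_qform_def q_def)
  next
    case 2
    have "(\<Sum>a\<in>UNIV. \<Sum>b\<in>UNIV. \<Sum>c\<in>UNIV. ?P a b c) = (\<Sum>a\<in>UNIV. \<Sum>c\<in>UNIV. \<Sum>b\<in>UNIV. ?P a b c)"
      by (subst (2) sum.swap) (rule refl)
    also have "\<dots> = (\<Sum>a\<in>UNIV. \<Sum>c\<in>UNIV. \<Sum>b\<in>UNIV.
        of_bool (a^2 + c * b = d \<and> n$1 * a + n$3 * c + n$2 * b = t))"
      by (simp add: algebra_simps del: sum_of_bool_eq)
    finally show ?thesis unfolding S
      by (subst (asm) count_section_oblique[OF odd 2]) (simp add: D_def dual_qform_def q_def mult.assoc mult.left_commute mult.commute)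
  next
    case 3
    have D: "D = (n$1)^2" "D \<noteq> 0" using 3 by (auto simp: D_def dual_qform_def)
    then have qD: "qchar D = 1" using 3 by (simp add: qchar_power2)
    define a0 where "a0 = t / n$1"
    have "(\<Sum>a\<in>UNIV. \<Sum>b\<in>UNIV. \<Sum>c\<in>UNIV. ?P a b c)
       = (\<Sum>a\<in>UNIV. if a = a0 then (\<Sum>b\<in>UNIV. \<Sum>c\<in>(UNIV::'a set). of_bool (b * c = d - a^2)) else 0)"
      by (rule sum_UNIV_cong) (use 3 in \<open>auto simp: a0_def field_simps simp del: sum_of_bool_eq intro!: sum.cong\<close>)
    also have "\<dots> = (\<Sum>b\<in>UNIV. \<Sum>c\<in>(UNIV::'a set). of_bool (b * c = d - a0^2))"
      by (simp del: sum_of_bool_eq)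
    also have "\<dots> = q - 1 + q * of_bool (d - a0^2 = 0)" by (simp only: count_hyperbola q_def)
    also have "d - a0^2 = 0 \<longleftrightarrow> D * d = t^2"
      using 3 D by (auto simp: a0_def field_simps)
    finally show ?thesis using S D qD by simp
  qed
qed

text \<open>
  For given \<open>a\<close> the other two coordinates lie on the hyperbola \<open>b c = d - a\<^sup>2\<close>.
\<close>

lemma card_quadric:
  assumes odd: "odd CARD('a::{field,finite})"
  shows "real (card {x::'a^3. qform x = d}) = real CARD('a)^2 + real CARD('a) * qchar d"
proof -
  let ?q = "real CARD('a)"
  have "real (card {x::'a^3. qform x = d}) = (\<Sum>a\<in>UNIV. \<Sum>b\<in>UNIV. \<Sum>c\<in>(UNIV::'a set). of_bool (b * c = d - a^2))"
    by (simp add: real_card_Collect sum_vec3 qform_def algebra_simps del: sum_of_bool_eq)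
  also have "\<dots> = (\<Sum>a\<in>(UNIV::'a set). ?q - 1 + ?q * of_bool (d - a^2 = 0))"
    by (simp only: count_hyperbola)
  also have "\<dots> = ?q * (?q - 1) + ?q * (\<Sum>a\<in>(UNIV::'a set). of_bool (a^2 = d))"
    by (simp add: sum.distrib sum_distrib_left eq_commute[of d] del: sum_of_bool_eq)
  also have "\<dots> = ?q^2 + ?q * qchar d"
    by (simp only: count_square_roots[OF odd]) (simp add: algebra_simps power2_eq_square)
  finally show ?thesis .
qed

lemma card_dual_quadric:
  assumes odd: "odd CARD('a::{field,finite})"
  shows "real (card {x::'a^3. dual_qform x = d}) = real CARD('a)^2 + real CARD('a) * qchar d"
proof -
  note four = odd_card_four_neq_0[OF odd]
  have "card {x::'a^3. dual_qform x = d} = card {x::'a^3. qform x = d}"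
  proof (rule bij_betw_same_card)
    show "bij_betw (\<lambda>x::'a^3. \<chi> i. if i = 2 then 4 * x$2 else x$i) {x. dual_qform x = d} {x. qform x = d}"
      by (rule bij_betw_byWitness[of _ "\<lambda>x. \<chi> i. if i = 2 then x$2 / 4 else x$i"])
        (use four in \<open>auto simp: vec_eq_iff qform_def dual_qform_def\<close>)
  qed
  then show ?thesis by (simp only: card_quadric[OF odd])
qed

text \<open>
  On nonzero elements the character has only two values, so every function of it is affine in it; and the
  character has sum \<open>0\<close>.
\<close>

lemma sum_over_qchar_classes:
  fixes f :: "real \<Rightarrow> real"
  assumes odd: "odd CARD('a::{field,finite})"
  shows "(\<Sum>e\<in>UNIV - {0::'a}. f (qchar e)) = (real CARD('a) - 1) / 2 * (f 1 + f (-1))"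
proof -
  have "(\<Sum>e\<in>UNIV - {0::'a}. f (qchar e)) = (\<Sum>e\<in>UNIV - {0::'a}. (f 1 + f (-1)) / 2 + qchar e * ((f 1 - f (-1)) / 2))"
    by (rule sum.cong) (auto simp: qchar_def field_simps)
  also have "\<dots> = (real CARD('a) - 1) * ((f 1 + f (-1)) / 2) + (\<Sum>e\<in>UNIV - {0::'a}. qchar e) * ((f 1 - f (-1)) / 2)"
    by (simp add: sum.distrib sum_distrib_right card_Diff_singleton of_nat_diff Suc_leI)
  also have "(\<Sum>e\<in>UNIV - {0::'a}. qchar e) = 0"
    using sum_qchar[OF odd] by (subst (asm) sum.remove[of _ 0]) auto
  finally show ?thesis by simp
qed

text \<open>
  The form of the sums over all planes that are needed below: the summand sees a normal vector only
  through the class of its dual form, and the number of normal vectors in each class is known.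
\<close>

lemma sum_over_normals:
  fixes h :: "'a::{field,finite}^3 \<Rightarrow> real" and f :: "real \<Rightarrow> real"
  assumes odd: "odd CARD('a)"
    and h: "\<And>n. n \<noteq> 0 \<Longrightarrow> h n = f (qchar (dual_qform n))"
  defines "q \<equiv> real CARD('a)"
  shows "(\<Sum>n\<in>UNIV. h n) = h 0 + (q^2 - 1) * f 0
    + (q - 1) / 2 * ((q^2 + q) * f 1 + (q^2 - q) * f (-1))"
proof -
  have [simp]: "dual_qform (0::'a^3) = 0" by (simp add: dual_qform_def)
  have "(\<Sum>n\<in>UNIV. h n) = h 0 + (\<Sum>n\<in>UNIV - {0}. h n)"
    by (rule sum.remove) auto
  also have "(\<Sum>n\<in>UNIV - {0}. h n) = (\<Sum>n\<in>UNIV - {0::'a^3}. f (qchar (dual_qform n)))"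
    by (rule sum.cong) (auto simp: h)
  also have "\<dots> = (\<Sum>n\<in>(UNIV::('a^3) set). f (qchar (dual_qform n))) - f 0"
    by (subst sum.remove[of UNIV "0::'a^3"]) auto
  also have "(\<Sum>n\<in>(UNIV::('a^3) set). f (qchar (dual_qform n)))
      = (\<Sum>e\<in>UNIV. \<Sum>n\<in>{n::'a^3. n \<in> UNIV \<and> dual_qform n = e}. f (qchar (dual_qform n)))"
    by (rule sum.group[symmetric]) auto
  also have "\<dots> = (\<Sum>e\<in>(UNIV::'a set). real (card {n::'a^3. dual_qform n = e}) * f (qchar e))"
    by simp
  also have "\<dots> = (\<Sum>e\<in>(UNIV::'a set). (q^2 + q * qchar e) * f (qchar e))"
    by (simp only: card_dual_quadric[OF odd] q_def)
  also have "\<dots> = q^2 * f 0 + (\<Sum>e\<in>UNIV - {0::'a}. (q^2 + q * qchar e) * f (qchar e))"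
    by (subst sum.remove[of _ 0]) auto
  also have "(\<Sum>e\<in>UNIV - {0::'a}. (q^2 + q * qchar e) * f (qchar e))
     = (q - 1) / 2 * ((q^2 + q) * f 1 + (q^2 - q) * f (-1))"
    by (subst sum_over_qchar_classes[OF odd, of "\<lambda>x. (q^2 + q * x) * f x"]) (simp add: q_def)
  finally show ?thesis by (simp add: algebra_simps)
qed

section \<open>Rank and annihilators\<close>

text \<open>
  Functionals are represented by their coefficient vectors.
\<close>

definition annihilator :: "('a::field^3) set \<Rightarrow> ('a^3) set" where
  "annihilator X = {n. \<forall>x\<in>X. scalar_product n x = 0}"

text \<open>
  Rank at most \<open>1\<close>. The vector \<open>e\<close> may be zero.
\<close>

definition on_line :: "('a::field^3) set \<Rightarrow> bool" where
  "on_line X \<longleftrightarrow> (\<exists>e. \<forall>x\<in>X. \<exists>c. x = c *s e)"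

lemma scalar_product_simps:
  fixes m n x y :: "'a::field^3"
  shows "scalar_product (m + n) x = scalar_product m x + scalar_product n x"
    and "scalar_product (m - n) x = scalar_product m x - scalar_product n x"
    and "scalar_product (c *s n) x = c * scalar_product n x"
    and "scalar_product 0 x = 0"
    and "scalar_product n 0 = 0"
    and "scalar_product n (x - y) = scalar_product n x - scalar_product n y"
    and "scalar_product n (c *s x) = c * scalar_product n x"
  by (simp_all add: scalar_product_3 algebra_simps)

lemma scalar_product_axis:
  "scalar_product (axis i c) x = c * x $ i" for x :: "'a::field^3"
  by (simp add: scalar_product_def axis_def if_distrib[of "\<lambda>a. a * _"] cong: if_cong)

lemma zero_in_annihilator [simp]: "0 \<in> annihilator X"
  by (simp add: annihilator_def scalar_product_simps)

lemma annihilator_antimono: "X \<subseteq> Y \<Longrightarrow> annihilator Y \<subseteq> annihilator X"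
  by (auto simp: annihilator_def)

text \<open>
  Adding a vector on which some functional does not yet vanish divides the annihilator by \<open>q\<close>: it is
  the kernel of the evaluation at that vector, which maps onto the field.
\<close>

lemma card_annihilator_insert:
  fixes x :: "'a::{field,finite}^3"
  assumes m: "m \<in> annihilator X" and mx: "scalar_product m x \<noteq> 0"
  shows "card (annihilator X) = CARD('a) * card (annihilator (insert x X))"
proof -
  have "bij_betw (\<lambda>(c,n). c *s m + n) (UNIV \<times> annihilator (insert x X)) (annihilator X)"
    by (rule bij_betw_byWitness[of _
          "\<lambda>n. (scalar_product n x / scalar_product m x, n - (scalar_product n x / scalar_product m x) *s m)"])
      (use m mx in \<open>auto simp: annihilator_def scalar_product_simps\<close>)
  then have "card (annihilator X) = card ((UNIV::'a set) \<times> annihilator (insert x X))"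
    by (simp only: bij_betw_same_card)
  then show ?thesis by (simp add: card_cartesian_product)
qed

lemma card_annihilator_empty: "card (annihilator ({} :: ('a::{field,finite}^3) set)) = CARD('a)^3"
  by (simp add: annihilator_def)

lemma card_annihilator_single:
  fixes u :: "'a::{field,finite}^3"
  assumes "u \<noteq> 0"
  shows "card (annihilator {u}) = CARD('a)^2"
proof -
  obtain i where "u $ i \<noteq> 0" using assms by (auto simp: vec_eq_iff)
  then have "scalar_product (axis i 1) u \<noteq> 0" by (simp add: scalar_product_axis)
  then have "CARD('a)^3 = CARD('a) * card (annihilator {u})"
    using card_annihilator_insert[of "axis i 1" "{}" u] card_annihilator_empty[where 'a='a]
    by (simp add: annihilator_def)
  then show ?thesis by (simp add: power2_eq_square power3_eq_cube)
qed

text \<open>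
  The functionals \<open>u\<^sub>i x\<^sub>j - u\<^sub>j x\<^sub>i\<close> vanish at \<open>u\<close>; vanishing at \<open>v\<close> says that \<open>u\<close> and \<open>v\<close> are proportional.
\<close>

lemma multiple_if_annihilated:
  fixes u v :: "'a::field^3"
  assumes u: "u \<noteq> 0" and ann: "\<And>n. n \<in> annihilator {u} \<Longrightarrow> scalar_product n v = 0"
  shows "\<exists>c. v = c *s u"
proof -
  have cross: "u $ i * v $ j = u $ j * v $ i" for i j
  proof -
    \<comment> \<open>the functional whose value at \<open>v\<close> is the \<open>2 \<times> 2\<close> minor of \<open>u\<close> and \<open>v\<close>\<close>
    let ?n = "axis j (u $ i) - axis i (u $ j)"
    have "?n \<in> annihilator {u}"
      by (simp add: annihilator_def scalar_product_simps scalar_product_axis)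
    then show ?thesis
      using ann[of ?n] by (simp add: scalar_product_simps scalar_product_axis)
  qed
  obtain i where i: "u $ i \<noteq> 0" using u by (auto simp: vec_eq_iff)
  then have "v = (v $ i / u $ i) *s u"
    using cross[of i] by (simp add: vec_eq_iff field_simps)
  then show ?thesis ..
qed

lemma card_annihilator_pair:
  fixes u v :: "'a::{field,finite}^3"
  assumes "u \<noteq> 0" "\<not> (\<exists>c. v = c *s u)"
  shows "card (annihilator {u, v}) = CARD('a)"
proof -
  obtain n where "n \<in> annihilator {u}" "scalar_product n v \<noteq> 0"
    using multiple_if_annihilated assms by blast
  then have "CARD('a)^2 = CARD('a) * card (annihilator {u, v})"
    using card_annihilator_insert[of n "{u}" v] card_annihilator_single[OF assms(1)]
    by (simp only: insert_commute simp_thms)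
  moreover have "0 < CARD('a)" by simp
  ultimately show ?thesis unfolding power2_eq_square mult_cancel1 by linarith
qed

lemma on_line_iff:
  assumes "u \<in> X" "u \<noteq> 0"
  shows "on_line X \<longleftrightarrow> (\<forall>x\<in>X. \<exists>c. x = c *s u)"
proof
  assume "on_line X"
  then obtain e where e: "\<forall>x\<in>X. \<exists>c. x = c *s e" by (auto simp: on_line_def)
  then obtain c where c: "u = c *s e" using assms by blast
  then have "c \<noteq> 0" using assms by auto
  then have "e = (1 / c) *s u" using c by (simp add: vector_smult_assoc)
  then have "k *s e = (k / c) *s u" for k by (simp add: vector_smult_assoc)
  then show "\<forall>x\<in>X. \<exists>c. x = c *s u" using e by metis
next
  assume "\<forall>x\<in>X. \<exists>c. x = c *s u"
  then show "on_line X" by (auto simp: on_line_def)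
qed

text \<open>
  The size of the annihilator is \<open>q\<close> to the corank. The case of corank at most \<open>1\<close> is left
  undivided, since the two values \<open>1\<close> and \<open>q\<close> are told apart by whether the vectors span.
\<close>

lemma card_annihilator_cases:
  fixes X :: "('a::{field,finite}^3) set"
  shows "X \<subseteq> {0} \<Longrightarrow> card (annihilator X) = CARD('a)^3"
    and "on_line X \<Longrightarrow> \<not> X \<subseteq> {0} \<Longrightarrow> card (annihilator X) = CARD('a)^2"
    and "\<not> on_line X \<Longrightarrow> card (annihilator X) \<in> {1, CARD('a)}"
proof -
  show "card (annihilator X) = CARD('a)^3" if "X \<subseteq> {0}"
  proof -
    from that have "annihilator X = UNIV" by (auto simp: annihilator_def scalar_product_simps)
    then show ?thesis by simp
  qed
  show "card (annihilator X) = CARD('a)^2" if line: "on_line X" and nz: "\<not> X \<subseteq> {0}"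
  proof -
    from nz obtain u where u: "u \<in> X" "u \<noteq> 0" by auto
    have "annihilator {u} \<subseteq> annihilator X"
    proof
      fix n assume "n \<in> annihilator {u}"
      then show "n \<in> annihilator X"
        using line on_line_iff[OF u] by (auto simp: annihilator_def) (metis mult_zero_right scalar_product_simps(7))
    qed
    then have "annihilator X = annihilator {u}"
      using annihilator_antimono[of "{u}" X] u by auto
    then show ?thesis using u by (simp add: card_annihilator_single)
  qed
  show "card (annihilator X) \<in> {1, CARD('a)}" if noline: "\<not> on_line X"
  proof -
    have "\<not> X \<subseteq> {0}"
    proof
      assume "X \<subseteq> {0}"
      then have "\<forall>x\<in>X. x = 0 *s 0" by auto
      then have "on_line X" unfolding on_line_def by metis
      then show False using noline by simp
    qed
    then obtain u where u: "u \<in> X" "u \<noteq> 0" by auto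
    then obtain v where v: "v \<in> X" "\<not> (\<exists>c. v = c *s u)" using noline on_line_iff by blast
    have card: "card (annihilator {u, v}) = CARD('a)" using card_annihilator_pair u v by blast
    have sub: "annihilator X \<subseteq> annihilator {u, v}" using u v by (intro annihilator_antimono) auto
    show ?thesis
    proof (cases "annihilator X = annihilator {u, v}")
      case True
      then show ?thesis using card by simp
    next
      case False
      then obtain n x where "n \<in> annihilator {u, v}" "x \<in> X" "scalar_product n x \<noteq> 0"
        using sub by (auto simp: annihilator_def)
      then have "CARD('a) = CARD('a) * card (annihilator {x, u, v})"
        using card_annihilator_insert card by metis
      then have "card (annihilator {x, u, v}) = 1" by simp
      moreover have "annihilator X \<subseteq> annihilator {x, u, v}"
        using u v \<open>x \<in> X\<close> by (intro annihilator_antimono) auto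
      ultimately have "card (annihilator X) \<le> 1" by (metis card_mono finite)
      moreover have "card (annihilator X) > 0" using zero_in_annihilator[of X] by (metis card_gt_0_iff empty_iff finite)
      ultimately show ?thesis by simp
    qed
  qed
qed

lemma annihilator_trivial_iff_card:
  fixes X :: "('a::{field,finite}^3) set"
  shows "annihilator X = {0} \<longleftrightarrow> card (annihilator X) = 1"
proof
  assume "card (annihilator X) = 1"
  then obtain n where "annihilator X = {n}" by (rule card_1_singletonE)
  moreover have "0 \<in> annihilator X" by simp
  ultimately show "annihilator X = {0}" by (metis singletonD)
qed simp

text \<open>
  On the left is the failure to span, the quantity to be counted. The terms on the right can all be
  summed over families of points of a quadric.
\<close>

lemma annihilator_rank_expansion:
  fixes X :: "('a::{field,finite}^3) set"
  defines "q \<equiv> real CARD('a)"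
  shows "(q - 1) * of_bool (annihilator X \<noteq> {0})
    = real (card (annihilator X)) - 1 - (q^2 - q) * of_bool (on_line X) - (q^3 - q^2) * of_bool (X \<subseteq> {0})"
proof -
  have two: "CARD('a) \<ge> 2" using card_mono[of UNIV "{0,1::'a}"] by simp
  have "1 < CARD('a)^2" "1 < CARD('a)^3" using two
    by (simp_all only: one_less_power numeral_2_eq_2 Suc_le_eq zero_less_Suc zero_less_numeral)
  then have big: "CARD('a)^2 \<noteq> 1" "CARD('a)^3 \<noteq> 1" by linarith+
  have line: "on_line X" if "X \<subseteq> {0}"
  proof -
    have "\<forall>x\<in>X. x = 0 *s 0" using that by auto
    then show ?thesis unfolding on_line_def by metis
  qed
  consider "X \<subseteq> {0}" | "\<not> X \<subseteq> {0}" "on_line X" | "\<not> X \<subseteq> {0}" "\<not> on_line X" by blast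
  then show ?thesis
  proof cases
    case 1
    then show ?thesis using card_annihilator_cases(1)[OF 1] line[OF 1] big
      by (simp add: annihilator_trivial_iff_card q_def)
  next
    case 2
    then show ?thesis using card_annihilator_cases(2)[OF 2(2,1)] big
      by (simp add: annihilator_trivial_iff_card q_def)
  next
    case 3
    then show ?thesis using card_annihilator_cases(3)[OF 3(2)] two
      by (auto simp: annihilator_trivial_iff_card q_def)
  qed
qed

lemma span_UNIV_iff_annihilator:
  fixes u v w :: "'a::{field,finite}^3"
  shows "vec.span {u, v, w} = UNIV \<longleftrightarrow> annihilator {u, v, w} = {0}"
proof -
  define A :: "'a^3^3" where "A = (\<chi> i. if i = 1 then u else if i = 2 then v else w)"
  have "rows A = (\<lambda>i. A $ i) ` UNIV"
    by (auto simp: rows_def row_def vec_lambda_eta)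
  also have "\<dots> = {A $ 1, A $ 2, A $ 3}" unfolding UNIV_3 by simp
  also have "\<dots> = {u, v, w}" by (simp add: A_def)
  finally have rows: "rows A = {u, v, w}" .
  have "vec.span (rows A) = UNIV \<longleftrightarrow> (\<forall>n. A *v n = 0 \<longrightarrow> n = 0)"
    by (simp only: matrix_left_invertible_span_rows_gen[symmetric] matrix_left_invertible_ker)
  moreover have "A *v n = 0 \<longleftrightarrow> n \<in> annihilator {u, v, w}" for n
  proof -
    have "n \<in> annihilator {u, v, w} \<longleftrightarrow>
        scalar_product n u = 0 \<and> scalar_product n v = 0 \<and> scalar_product n w = 0"
      by (auto simp: annihilator_def)
    also have "\<dots> \<longleftrightarrow> A *v n = 0"
      by (simp add: vec_eq_iff forall_3 A_def matrix_vector_mult_def scalar_product_3 sum_3 mult.commute)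
    finally show ?thesis by simp
  qed
  ultimately show ?thesis unfolding rows
    using zero_in_annihilator[of "{u, v, w}"] by (auto simp del: zero_in_annihilator)
qed

text \<open>
  A functional vanishes on a triple if each of the three points lies in its kernel, so it is counted
  once for each triple of points of the plane section.
\<close>

lemma sum_card_annihilator_triples:
  fixes S :: "('a::{field,finite}^3) set"
  shows "(\<Sum>u\<in>S. \<Sum>v\<in>S. \<Sum>w\<in>S. real (card (annihilator {u, v, w})))
    = (\<Sum>n\<in>UNIV. real (card {x\<in>S. scalar_product n x = 0})^3)"
proof -
  let ?b = "\<lambda>n x. of_bool (scalar_product n x = 0) :: real"
  have s: "(\<Sum>x\<in>S. ?b n x) = real (card {x\<in>S. scalar_product n x = 0})" for n
    by (simp add: Int_def)
  have "(\<Sum>u\<in>S. \<Sum>v\<in>S. \<Sum>w\<in>S. real (card (annihilator {u, v, w})))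
     = (\<Sum>u\<in>S. \<Sum>v\<in>S. \<Sum>w\<in>S. \<Sum>n\<in>UNIV. ?b n u * (?b n v * ?b n w))"
    by (simp add: annihilator_def real_card_Collect of_bool_conj del: sum_of_bool_eq)
  also have "\<dots> = (\<Sum>n\<in>UNIV. \<Sum>u\<in>S. \<Sum>v\<in>S. \<Sum>w\<in>S. ?b n u * (?b n v * ?b n w))"
    by (simp only: sum.swap[of _ UNIV S])
  also have "\<dots> = (\<Sum>n\<in>UNIV. (\<Sum>u\<in>S. ?b n u) * ((\<Sum>v\<in>S. ?b n v) * (\<Sum>w\<in>S. ?b n w)))"
    by (simp only: sum_distrib_left[symmetric] sum_distrib_right[symmetric])
  finally show ?thesis by (simp only: s) (simp add: power3_eq_cube mult.assoc)
qed

text \<open>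
  A functional vanishes on the differences if all four points lie in one of the planes on which it is
  constant; the value \<open>t\<close> there is the one at \<open>x\<close>.
\<close>

lemma sum_card_annihilator_differences:
  fixes S :: "('a::{field,finite}^3) set"
  shows "(\<Sum>x\<in>S. \<Sum>y\<in>S. \<Sum>z\<in>S. \<Sum>w\<in>S. real (card (annihilator {y - x, z - x, w - x})))
    = (\<Sum>n\<in>UNIV. \<Sum>t\<in>UNIV. real (card {x\<in>S. scalar_product n x = t})^4)"
proof -
  let ?b = "\<lambda>n t x. of_bool (scalar_product n x = t) :: real"
  let ?s = "\<lambda>n t. real (card {x\<in>S. scalar_product n x = t})"
  have s: "(\<Sum>x\<in>S. ?b n t x) = ?s n t" for n t
    by (simp add: Int_def)
  have "(\<Sum>x\<in>S. \<Sum>y\<in>S. \<Sum>z\<in>S. \<Sum>w\<in>S. real (card (annihilator {y - x, z - x, w - x})))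
     = (\<Sum>x\<in>S. \<Sum>y\<in>S. \<Sum>z\<in>S. \<Sum>w\<in>S. \<Sum>n\<in>UNIV.
         ?b n (scalar_product n x) y * (?b n (scalar_product n x) z * ?b n (scalar_product n x) w))"
    by (simp add: annihilator_def real_card_Collect of_bool_conj scalar_product_simps del: sum_of_bool_eq)
  also have "\<dots> = (\<Sum>n\<in>UNIV. \<Sum>x\<in>S. \<Sum>y\<in>S. \<Sum>z\<in>S. \<Sum>w\<in>S.
         ?b n (scalar_product n x) y * (?b n (scalar_product n x) z * ?b n (scalar_product n x) w))"
    by (simp only: sum.swap[of _ UNIV S])
  also have "\<dots> = (\<Sum>n\<in>UNIV. \<Sum>x\<in>S. (\<Sum>y\<in>S. ?b n (scalar_product n x) y)
       * ((\<Sum>z\<in>S. ?b n (scalar_product n x) z) * (\<Sum>w\<in>S. ?b n (scalar_product n x) w)))"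
    by (simp only: sum_distrib_left[symmetric] sum_distrib_right[symmetric])
  also have "\<dots> = (\<Sum>n\<in>UNIV. \<Sum>x\<in>S. ?s n (scalar_product n x)^3)"
    by (simp add: s power3_eq_cube mult.assoc)
  also have "\<dots> = (\<Sum>n\<in>UNIV. \<Sum>t\<in>UNIV. \<Sum>x\<in>{x\<in>S. scalar_product n x = t}. ?s n (scalar_product n x)^3)"
    by (subst sum.group) auto
  also have "\<dots> = (\<Sum>n\<in>UNIV. \<Sum>t\<in>UNIV. ?s n t^4)"
    by (intro sum.cong refl) (simp add: power4_eq_xxxx power3_eq_cube mult.assoc)
  finally show ?thesis .
qed

section \<open>Non-spanning families on a quadric\<close>

lemma sum_of_bool_card: "finite S \<Longrightarrow> (\<Sum>x\<in>S. of_bool (P x)) = real (card {x\<in>S. P x})"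
  by (simp add: Int_def)

lemma qform_scale: "qform (c *s x) = c^2 * qform x"
  by (simp add: qform_def algebra_simps power2_eq_square)

lemma qform_0 [simp]: "qform 0 = 0"
  by (simp add: qform_def)

lemma sum_on_line_triples:
  fixes S :: "('a::{field,finite}^3) set"
  assumes "0 \<notin> S"
  shows "(\<Sum>u\<in>S. \<Sum>v\<in>S. \<Sum>w\<in>S. of_bool (on_line {u, v, w}))
    = (\<Sum>u\<in>S. real (card {v\<in>S. \<exists>c. v = c *s u})^2)"
proof (rule sum.cong[OF refl])
  fix u assume "u \<in> S"
  then have u: "u \<noteq> 0" using assms by auto
  have line: "on_line {u, v, w} \<longleftrightarrow> (\<exists>c. v = c *s u) \<and> (\<exists>c. w = c *s u)" for v w
  proof -
    have "\<exists>c. u = c *s u" by (rule exI[of _ 1]) simp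
    then show ?thesis using on_line_iff[of u "{u, v, w}"] u by simp
  qed
  have "(\<Sum>v\<in>S. \<Sum>w\<in>S. of_bool (on_line {u, v, w}) :: real)
    = (\<Sum>v\<in>S. \<Sum>w\<in>S. of_bool (\<exists>c. v = c *s u) * of_bool (\<exists>c. w = c *s u))"
    by (simp only: line of_bool_conj)
  also have "\<dots> = (\<Sum>v\<in>S. of_bool (\<exists>c. v = c *s u)) * (\<Sum>w\<in>S. of_bool (\<exists>c. w = c *s u))"
    by (simp only: sum_product)
  also have "\<dots> = real (card {v\<in>S. \<exists>c. v = c *s u})^2"
    by (simp only: sum_of_bool_card finite power2_eq_square)
  finally show "(\<Sum>v\<in>S. \<Sum>w\<in>S. of_bool (on_line {u, v, w})) = real (card {v\<in>S. \<exists>c. v = c *s u})^2" .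
qed

text \<open>
  The term for rank \<open>0\<close> is absent as no point of \<open>S\<close> is the origin.
\<close>

lemma dependent_triples:
  fixes S :: "('a::{field,finite}^3) set"
  assumes "0 \<notin> S"
  defines "q \<equiv> real CARD('a)"
  shows "(q - 1) * (\<Sum>u\<in>S. \<Sum>v\<in>S. \<Sum>w\<in>S. of_bool (annihilator {u, v, w} \<noteq> {0}))
    = (\<Sum>n\<in>UNIV. real (card {x\<in>S. scalar_product n x = 0})^3) - real (card S)^3
      - (q^2 - q) * (\<Sum>u\<in>S. real (card {v\<in>S. \<exists>c. v = c *s u})^2)"
proof -
  have "(q - 1) * (\<Sum>u\<in>S. \<Sum>v\<in>S. \<Sum>w\<in>S. of_bool (annihilator {u, v, w} \<noteq> {0}))
    = (\<Sum>u\<in>S. \<Sum>v\<in>S. \<Sum>w\<in>S. (q - 1) * of_bool (annihilator {u, v, w} \<noteq> {0}))"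
    by (simp only: sum_distrib_left)
  also have "\<dots> = (\<Sum>u\<in>S. \<Sum>v\<in>S. \<Sum>w\<in>S. real (card (annihilator {u, v, w})) - 1
      - (q^2 - q) * of_bool (on_line {u, v, w}) - 0)"
  proof (intro sum.cong refl)
    fix u v w assume "u \<in> S"
    then have "\<not> {u, v, w} \<subseteq> {0}" using assms by auto
    then show "(q - 1) * of_bool (annihilator {u, v, w} \<noteq> {0}) = real (card (annihilator {u, v, w})) - 1
      - (q^2 - q) * of_bool (on_line {u, v, w}) - 0"
      using annihilator_rank_expansion[of "{u, v, w}"] by (simp only: q_def of_bool_eq simp_thms mult_zero_right)
  qed
  also have "\<dots> = (\<Sum>u\<in>S. \<Sum>v\<in>S. \<Sum>w\<in>S. real (card (annihilator {u, v, w}))) - real (card S)^3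
      - (q^2 - q) * (\<Sum>u\<in>S. \<Sum>v\<in>S. \<Sum>w\<in>S. of_bool (on_line {u, v, w}))"
    by (simp only: sum_subtractf sum_distrib_left[symmetric] diff_0_right)
      (simp add: power3_eq_cube)
  finally show ?thesis
    by (simp only: sum_on_line_triples[OF assms(1)] sum_card_annihilator_triples)
qed

text \<open>
  The line is determined by the first of \<open>y\<close>, \<open>z\<close>, \<open>w\<close> that differs from \<open>x\<close>. If it is \<open>y\<close>, then \<open>z\<close> and \<open>w\<close>
  are free on that line; if it is \<open>z\<close>, then only \<open>w\<close> is free; the remaining summands are those
  with \<open>w\<close> alone different from \<open>x\<close>, and the constant quadruple.
\<close>

lemma sum_on_line_differences:
  fixes S :: "('a::{field,finite}^3) set"
  assumes x: "x \<in> S"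
  defines "l \<equiv> \<lambda>y. real (card {z\<in>S. \<exists>c. z - x = c *s (y - x)})"
  shows "(\<Sum>y\<in>S. \<Sum>z\<in>S. \<Sum>w\<in>S. of_bool (on_line {y - x, z - x, w - x}))
    = 1 + (\<Sum>y\<in>S - {x}. 1 + l y + l y^2)"
proof -
  let ?b = "\<lambda>y z. of_bool (\<exists>c. z - x = c *s (y - x)) :: real"
  have self: "\<exists>c. u = c *s u" "\<exists>c. 0 = c *s u" for u :: "'a^3"
    by (rule exI[of _ 1], simp) (rule exI[of _ 0], simp)
  have l: "(\<Sum>z\<in>S. ?b y z) = l y" for y
    by (simp only: sum_of_bool_card finite l_def)
  have three: "(\<Sum>z\<in>S. \<Sum>w\<in>S. of_bool (on_line {y - x, z - x, w - x})) = l y^2" if "y \<noteq> x" for y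
  proof -
    have "on_line {y - x, z - x, w - x} \<longleftrightarrow> (\<exists>c. z - x = c *s (y - x)) \<and> (\<exists>c. w - x = c *s (y - x))" for z w
      using on_line_iff[of "y - x" "{y - x, z - x, w - x}"] that self(1)[of "y - x"] by simp
    then have "(\<Sum>z\<in>S. \<Sum>w\<in>S. of_bool (on_line {y - x, z - x, w - x})) = (\<Sum>z\<in>S. \<Sum>w\<in>S. ?b y z * ?b y w)"
      by (simp only: of_bool_conj)
    also have "\<dots> = l y * l y" by (simp only: sum_product[symmetric] l)
    finally show ?thesis by (simp only: power2_eq_square)
  qed
  have two: "(\<Sum>w\<in>S. of_bool (on_line {x - x, z - x, w - x})) = l z" if "z \<noteq> x" for z
  proof -
    have "on_line {x - x, z - x, w - x} \<longleftrightarrow> (\<exists>c. w - x = c *s (z - x))" for w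
      using on_line_iff[of "z - x" "{x - x, z - x, w - x}"] that self(1)[of "z - x"] self(2)[of "z - x"] by simp
    then show ?thesis by (simp only: l)
  qed
  have one: "(\<Sum>w\<in>S. of_bool (on_line {x - x, x - x, w - x})) = real (card S)"
  proof -
    have "on_line {x - x, x - x, w - x}" for w
      unfolding on_line_def using self[of "w - x"] by (intro exI[of _ "w - x"]) simp
    then show ?thesis by simp
  qed
  have "(\<Sum>y\<in>S. \<Sum>z\<in>S. \<Sum>w\<in>S. of_bool (on_line {y - x, z - x, w - x}))
    = (\<Sum>z\<in>S. \<Sum>w\<in>S. of_bool (on_line {x - x, z - x, w - x}))
      + (\<Sum>y\<in>S - {x}. \<Sum>z\<in>S. \<Sum>w\<in>S. of_bool (on_line {y - x, z - x, w - x}))"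
    by (rule sum.remove) (use x in auto)
  also have "(\<Sum>y\<in>S - {x}. \<Sum>z\<in>S. \<Sum>w\<in>S. of_bool (on_line {y - x, z - x, w - x})) = (\<Sum>y\<in>S - {x}. l y^2)"
    by (rule sum.cong) (use three in auto)
  also have "(\<Sum>z\<in>S. \<Sum>w\<in>S. of_bool (on_line {x - x, z - x, w - x}))
    = (\<Sum>w\<in>S. of_bool (on_line {x - x, x - x, w - x}))
      + (\<Sum>z\<in>S - {x}. \<Sum>w\<in>S. of_bool (on_line {x - x, z - x, w - x}))"
    by (rule sum.remove) (use x in auto)
  also have "(\<Sum>z\<in>S - {x}. \<Sum>w\<in>S. of_bool (on_line {x - x, z - x, w - x})) = (\<Sum>z\<in>S - {x}. l z)"
    by (rule sum.cong) (use two in auto)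
  also have "(\<Sum>w\<in>S. of_bool (on_line {x - x, x - x, w - x})) = 1 + (\<Sum>y\<in>S - {x}. 1::real)"
  proof -
    have "real (card S) = (\<Sum>y\<in>S. 1)" by simp
    also have "\<dots> = 1 + (\<Sum>y\<in>S - {x}. 1)" by (rule sum.remove) (use x in auto)
    finally show ?thesis by (simp only: one)
  qed
  finally show ?thesis by (simp only: sum.distrib add.assoc add.commute add.left_commute)
qed

lemma coplanar_quadruples:
  fixes S :: "('a::{field,finite}^3) set"
  defines "q \<equiv> real CARD('a)"
    and "l \<equiv> \<lambda>x y. real (card {z\<in>S. \<exists>c. z - x = c *s (y - x)})"
  shows "(q - 1) * (\<Sum>x\<in>S. \<Sum>y\<in>S. \<Sum>z\<in>S. \<Sum>w\<in>S. of_bool (annihilator {y - x, z - x, w - x} \<noteq> {0}))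
    = (\<Sum>n\<in>UNIV. \<Sum>t\<in>UNIV. real (card {x\<in>S. scalar_product n x = t})^4) - real (card S)^4
      - (q^2 - q) * (\<Sum>x\<in>S. 1 + (\<Sum>y\<in>S - {x}. 1 + l x y + l x y^2)) - (q^3 - q^2) * real (card S)"
proof -
  have zero: "(\<Sum>y\<in>S. \<Sum>z\<in>S. \<Sum>w\<in>S. of_bool ({y - x, z - x, w - x} \<subseteq> {0})) = (1::real)" if "x \<in> S" for x
  proof -
    have "(\<Sum>y\<in>S. \<Sum>z\<in>S. \<Sum>w\<in>S. of_bool ({y - x, z - x, w - x} \<subseteq> {0}))
      = (\<Sum>y\<in>S. \<Sum>z\<in>S. \<Sum>w\<in>S. of_bool (y = x) * (of_bool (z = x) * (of_bool (w = x) :: real)))"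
      by (simp add: of_bool_conj del: sum_of_bool_eq)
    also have "\<dots> = (\<Sum>y\<in>S. of_bool (y = x)) * ((\<Sum>z\<in>S. of_bool (z = x)) * (\<Sum>w\<in>S. of_bool (w = x)))"
      by (simp only: sum_distrib_left[symmetric] sum_distrib_right[symmetric])
    also have "(\<Sum>w\<in>S. of_bool (w = x)) = (1::real)"
      using that by (simp add: of_bool_def sum.delta del: sum_of_bool_eq)
    finally show ?thesis by simp
  qed
  have "(q - 1) * (\<Sum>x\<in>S. \<Sum>y\<in>S. \<Sum>z\<in>S. \<Sum>w\<in>S. of_bool (annihilator {y - x, z - x, w - x} \<noteq> {0}))
    = (\<Sum>x\<in>S. \<Sum>y\<in>S. \<Sum>z\<in>S. \<Sum>w\<in>S. (q - 1) * of_bool (annihilator {y - x, z - x, w - x} \<noteq> {0}))"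
    by (simp only: sum_distrib_left)
  also have "\<dots> = (\<Sum>x\<in>S. \<Sum>y\<in>S. \<Sum>z\<in>S. \<Sum>w\<in>S. real (card (annihilator {y - x, z - x, w - x})) - 1
      - (q^2 - q) * of_bool (on_line {y - x, z - x, w - x}) - (q^3 - q^2) * of_bool ({y - x, z - x, w - x} \<subseteq> {0}))"
    unfolding q_def by (intro sum.cong refl annihilator_rank_expansion)
  also have "\<dots> = (\<Sum>x\<in>S. \<Sum>y\<in>S. \<Sum>z\<in>S. \<Sum>w\<in>S. real (card (annihilator {y - x, z - x, w - x})))
     - (\<Sum>x\<in>S. \<Sum>y\<in>S. \<Sum>z\<in>S. \<Sum>w\<in>S. 1)
     - (q^2 - q) * (\<Sum>x\<in>S. \<Sum>y\<in>S. \<Sum>z\<in>S. \<Sum>w\<in>S. of_bool (on_line {y - x, z - x, w - x}))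
     - (q^3 - q^2) * (\<Sum>x\<in>S. \<Sum>y\<in>S. \<Sum>z\<in>S. \<Sum>w\<in>S. of_bool ({y - x, z - x, w - x} \<subseteq> {0}))"
    by (simp only: sum_subtractf sum_distrib_left[symmetric])
  also have "(\<Sum>x\<in>S. \<Sum>y\<in>S. \<Sum>z\<in>S. \<Sum>w\<in>S. of_bool ({y - x, z - x, w - x} \<subseteq> {0}))
      = real (card S)"
    using sum.cong[OF refl zero, of S] by simp
  also have "(\<Sum>x\<in>S. \<Sum>y\<in>S. \<Sum>z\<in>S. \<Sum>w\<in>S. of_bool (on_line {y - x, z - x, w - x}))
    = (\<Sum>x\<in>S. 1 + (\<Sum>y\<in>S - {x}. 1 + l x y + l x y^2))"
    unfolding l_def by (rule sum.cong[OF refl]) (rule sum_on_line_differences)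
  also have "(\<Sum>x\<in>S. \<Sum>y\<in>S. \<Sum>z\<in>S. \<Sum>w\<in>S. (1::real)) = real (card S)^4"
    by (simp add: power4_eq_xxxx mult.assoc)
  finally show ?thesis by (simp only: sum_card_annihilator_differences)
qed

lemma card_quadric_multiples:
  fixes u :: "'a::{field,finite}^3"
  assumes odd: "odd CARD('a)" and d: "d \<noteq> 0" and u: "qform u = d"
  shows "card {v\<in>{x. qform x = d}. \<exists>c. v = c *s u} = 2"
proof -
  have u0: "u \<noteq> 0" using d u by auto
  then obtain i where i: "u $ i \<noteq> 0" by (auto simp: vec_eq_iff)
  have "u \<noteq> - u"
  proof
    assume "u = - u"
    then have "u $ i = - u $ i" by (metis vector_uminus_component)
    then have "2 * u $ i = 0" by (metis add.right_inverse mult_2)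
    then show False using i odd_card_two_neq_0[OF odd] by simp
  qed
  moreover have "{v\<in>{x. qform x = d}. \<exists>c. v = c *s u} = {u, - u}"
  proof (rule set_eqI, rule iffI)
    fix v assume "v \<in> {v\<in>{x. qform x = d}. \<exists>c. v = c *s u}"
    then obtain c where c: "v = c *s u" and "qform v = d" by auto
    then have "c^2 * d = d" using u by (simp only: qform_scale)
    with c have "v = c *s u" "c = 1 \<or> c = -1" using d by (auto simp: power2_eq_1_iff)
    then show "v \<in> {u, - u}" by (auto simp: vec_eq_iff)
  next
    fix v assume "v \<in> {u, - u}"
    then have "v = 1 *s u \<or> v = (-1) *s u" by (auto simp: vec_eq_iff)
    then obtain c where "v = c *s u" "c^2 = 1" by fastforce
    then show "v \<in> {v\<in>{x. qform x = d}. \<exists>c. v = c *s u}" using u by (auto simp: qform_scale)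
  qed
  ultimately show ?thesis by simp
qed

lemma card_cone_multiples:
  fixes u :: "'a::{field,finite}^3"
  assumes u: "qform u = 0" "u \<noteq> 0"
  shows "card {v\<in>{x. x \<noteq> 0 \<and> qform x = 0}. \<exists>c. v = c *s u} = CARD('a) - 1"
proof -
  obtain i where i: "u $ i \<noteq> 0" using u by (auto simp: vec_eq_iff)
  have "{v\<in>{x. x \<noteq> 0 \<and> qform x = 0}. \<exists>c. v = c *s u} = (\<lambda>c. c *s u) ` (UNIV - {0})"
    using u by (auto simp: qform_scale)
  moreover have "inj_on (\<lambda>c. c *s u) (UNIV - {0})"
    using i by (auto simp: inj_on_def vec_eq_iff)
  ultimately show ?thesis by (simp add: card_image card_Diff_singleton)
qed

text \<open>
  A quadratic polynomial in \<open>c\<close> that takes the value \<open>d\<close> at \<open>0\<close> and at \<open>1\<close>.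
\<close>

lemma qform_line:
  fixes x y :: "'a::field^3"
  assumes "qform x = d" "qform y = d"
  shows "qform (x + c *s (y - x)) = d + c * (c - 1) * qform (y - x)"
proof -
  have "qform (x + c *s (y - x)) = (1 - c) * qform x + c * qform y + c * (c - 1) * qform (y - x)"
    by (simp add: qform_def algebra_simps power2_eq_square)
  then show ?thesis using assms by (simp add: algebra_simps)
qed

text \<open>
  By \<open>qform_line\<close> the third and further intersections exist only if the direction \<open>y - x\<close> is
  isotropic, and then the whole line lies on the quadric.
\<close>

lemma card_quadric_secant:
  fixes x y :: "'a::{field,finite}^3"
  assumes x: "qform x = d" and y: "qform y = d" and xy: "y \<noteq> x"
  shows "card {z\<in>{x. qform x = d}. \<exists>c. z - x = c *s (y - x)} = (if qform (y - x) = 0 then CARD('a) else 2)"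
proof -
  let ?p = "\<lambda>c. x + c *s (y - x)"
  have inj: "inj_on ?p A" for A
  proof (rule inj_onI)
    fix a b assume "?p a = ?p b"
    then have "a *s (y - x) = b *s (y - x)" by (simp only: add_left_cancel)
    then show "a = b" using xy by (simp only: vec.scale_cancel_right right_minus_eq simp_thms)
  qed
  have "{z\<in>{x. qform x = d}. \<exists>c. z - x = c *s (y - x)} = ?p ` {c. c * (c - 1) * qform (y - x) = 0}"
  proof (rule set_eqI, rule iffI)
    fix z assume "z \<in> {z\<in>{x. qform x = d}. \<exists>c. z - x = c *s (y - x)}"
    then obtain c where c: "qform z = d" "z - x = c *s (y - x)" by auto
    then have "z = ?p c" by (metis add_diff_cancel_left' add_diff_eq)
    moreover from this c have "c * (c - 1) * qform (y - x) = 0" using qform_line[OF x y, of c] by simp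
    ultimately show "z \<in> ?p ` {c. c * (c - 1) * qform (y - x) = 0}" by blast
  next
    fix z assume "z \<in> ?p ` {c. c * (c - 1) * qform (y - x) = 0}"
    then obtain c where "z = ?p c" "c * (c - 1) * qform (y - x) = 0" by blast
    then show "z \<in> {z\<in>{x. qform x = d}. \<exists>c. z - x = c *s (y - x)}"
      using qform_line[OF x y, of c] by auto
  qed
  then have card: "card {z\<in>{x. qform x = d}. \<exists>c. z - x = c *s (y - x)}
      = card {c. c * (c - 1) * qform (y - x) = 0}"
    using card_image[OF inj] by simp
  show ?thesis
  proof (cases "qform (y - x) = 0")
    case True
    then show ?thesis unfolding card by simp
  next
    case False
    then have "{c. c * (c - 1) * qform (y - x) = 0} = {0, 1}" by auto
    then show ?thesis unfolding card using False by simp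
  qed
qed

text \<open>
  The line from \<open>x\<close> in direction \<open>r\<close> lies on the quadric if \<open>r\<close> is isotropic and orthogonal to \<open>x\<close>. So the
  directions form a plane section through the vertex of the cone \<open>qform r = 0\<close>, by the plane with normal
  vector the polar of \<open>x\<close>, whose dual form is \<open>4 d\<close>. This is the pair of rulings when \<open>d\<close> is a square, and
  only the vertex otherwise.
\<close>

lemma card_quadric_ruling:
  fixes x :: "'a::{field,finite}^3"
  assumes odd: "odd CARD('a)" and d: "d \<noteq> 0" and x: "qform x = d"
  shows "real (card {y\<in>{y. qform y = d} - {x}. qform (y - x) = 0}) = (real CARD('a) - 1) * (1 + qchar d)"
proof -
  let ?q = "real CARD('a)"
  \<comment> \<open>\<open>scalar_product n r\<close> is the polar form of \<open>qform\<close> at \<open>x\<close> and \<open>r\<close>\<close>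
  define n :: "'a^3" where "n = (\<chi> i. if i = 1 then 2 * x$1 else if i = 2 then x$3 else x$2)"
  have n_nth: "n$1 = 2 * x$1" "n$2 = x$3" "n$3 = x$2" by (simp_all add: n_def)
  have D: "dual_qform n = 2^2 * d"
    unfolding x[symmetric] by (simp add: dual_qform_def qform_def n_nth algebra_simps power2_eq_square)
  have D0: "dual_qform n \<noteq> 0" using D d odd_card_four_neq_0[OF odd] by simp
  then have n0: "n \<noteq> 0" by (auto simp: dual_qform_def)
  have qD: "qchar (dual_qform n) = qchar d"
    unfolding D by (rule qchar_power2_mult[OF odd odd_card_two_neq_0[OF odd]])
  \<comment> \<open>so a point \<open>x + r\<close> with isotropic \<open>r\<close> is on the quadric if and only if \<open>r\<close> is orthogonal to \<open>x\<close>\<close>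
  have polar: "qform (x + r) = d + qform r + scalar_product n r" for r
    unfolding x[symmetric] by (simp add: qform_def scalar_product_3 n_nth algebra_simps power2_eq_square)
  have "{y\<in>{y. qform y = d} - {x}. qform (y - x) = 0}
      = (\<lambda>r. x + r) ` ({r. qform r = 0 \<and> scalar_product n r = 0} - {0})"
  proof (rule set_eqI, rule iffI)
    fix y assume y: "y \<in> {y\<in>{y. qform y = d} - {x}. qform (y - x) = 0}"
    then have "y - x \<in> {r. qform r = 0 \<and> scalar_product n r = 0} - {0}"
      using polar[of "y - x"] by simp
    then show "y \<in> (\<lambda>r. x + r) ` ({r. qform r = 0 \<and> scalar_product n r = 0} - {0})"
      by (intro image_eqI[of _ _ "y - x"]) simp_all
  qed (use polar in auto)
  then have "card {y\<in>{y. qform y = d} - {x}. qform (y - x) = 0}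
      = card ({r. qform r = 0 \<and> scalar_product n r = 0} - {0})"
    by (simp only: card_image inj_on_add)
  also have "real \<dots> = real (card {r. qform r = 0 \<and> scalar_product n r = 0}) - 1"
  proof -
    have z: "0 \<in> {r. qform r = 0 \<and> scalar_product n r = 0}" by (simp add: scalar_product_simps)
    then have "card {r. qform r = 0 \<and> scalar_product n r = 0} > 0" using card_gt_0_iff by fastforce
    then show ?thesis using z by (simp add: card_Diff_singleton of_nat_diff Suc_leI)
  qed
  also have "real (card {r. qform r = 0 \<and> scalar_product n r = 0}) = ?q - qchar d + ?q * qchar d"
    using D0 by (simp add: card_section[OF odd n0] qD)
  finally show ?thesis by (simp add: algebra_simps)
qed

text \<open>
  The first two summands come from the planes through the origin, other than the term for the zero
  functional, which cancels against the number of all triples. The last one corrects for the collinear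
  triples, four for each \<open>u\<close>.
\<close>

lemma dependent_triples_quadric:
  fixes d :: "'a::{field,finite}"
  assumes odd: "odd CARD('a)" and d: "d \<noteq> 0"
  defines "S \<equiv> {x. qform x = d}" and "q \<equiv> real CARD('a)" and "\<epsilon> \<equiv> qchar d"
  shows "(q - 1) * (\<Sum>u\<in>S. \<Sum>v\<in>S. \<Sum>w\<in>S. of_bool (annihilator {u, v, w} \<noteq> {0}))
    = (q^2 - 1) * (q * (1 + \<epsilon>))^3 + (q - 1) / 2 * ((q^2 + q) * (q - 1)^3 + (q^2 - q) * (q + 1)^3)
      - (q^2 - q) * (4 * (q^2 + q * \<epsilon>))"
proof -
  define f where "f = (\<lambda>e::real. if e = 0 then (q * (1 + \<epsilon>))^3 else (q - e)^3)"
  have card: "real (card S) = q^2 + q * \<epsilon>"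
    unfolding S_def q_def \<epsilon>_def by (rule card_quadric[OF odd])
  have h: "real (card {x\<in>S. scalar_product n x = 0})^3 = f (qchar (dual_qform n))" if "n \<noteq> 0" for n :: "'a^3"
  proof -
    let ?D = "dual_qform n"
    have "real (card {x\<in>S. scalar_product n x = 0})
        = q - qchar ?D + q * (if ?D = 0 then \<epsilon> else qchar ?D) * of_bool (?D * d = 0)"
      using card_section[OF odd that, of d 0] by (simp add: S_def q_def \<epsilon>_def)
    then show ?thesis using d by (simp add: f_def distrib_left)
  qed
  have h0: "real (card {x\<in>S. scalar_product 0 x = 0})^3 = real (card S)^3"
    by (simp add: scalar_product_simps)
  have "(\<Sum>n\<in>(UNIV::('a^3) set). real (card {x\<in>S. scalar_product n x = 0})^3) = real (card S)^3
    + (q^2 - 1) * f 0 + (q - 1) / 2 * ((q^2 + q) * f 1 + (q^2 - q) * f (-1))"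
    unfolding q_def by (subst sum_over_normals[OF odd, where f = f]) (use h h0 in auto)
  moreover have "(\<Sum>u\<in>S. real (card {v\<in>S. \<exists>c. v = c *s u})^2) = 4 * real (card S)"
    using card_quadric_multiples[OF odd d] by (simp add: S_def)
  moreover have "0 \<notin> S" using d by (simp add: S_def)
  moreover have "f 0 = (q * (1 + \<epsilon>))^3" "f 1 = (q - 1)^3" "f (-1) = (q + 1)^3" by (simp_all add: f_def)
  moreover note dependent_triples[of S, folded q_def]
  ultimately show ?thesis
    by (simp only: card simp_thms)
qed

lemma card_cone_restrict:
  assumes "P 0"
  shows "real (card {x::'a::{field,finite}^3. x \<noteq> 0 \<and> qform x = 0 \<and> P x}) = real (card {x. qform x = 0 \<and> P x}) - 1"
proof -
  have "{x::'a^3. x \<noteq> 0 \<and> qform x = 0 \<and> P x} = {x. qform x = 0 \<and> P x} - {0}" by auto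
  moreover have z: "0 \<in> {x::'a^3. qform x = 0 \<and> P x}" using assms by simp
  moreover from z have "card {x::'a^3. qform x = 0 \<and> P x} > 0" using card_gt_0_iff by fastforce
  ultimately show ?thesis by (simp add: card_Diff_singleton of_nat_diff Suc_leI)
qed

lemma card_cone:
  assumes odd: "odd CARD('a::{field,finite})"
  shows "real (card {x::'a^3. x \<noteq> 0 \<and> qform x = 0}) = real CARD('a)^2 - 1"
  using card_cone_restrict[of "\<lambda>_::'a^3. True"] card_quadric[OF odd, of 0] by simp

text \<open>
  The count for the nilpotent orbit. Each plane through the origin contains the vertex of the cone, which is
  removed; hence the values \<open>q - 1\<close>, \<open>2 (q - 1)\<close> and \<open>0\<close> for tangent, secant and exterior planes.
\<close>

lemma dependent_triples_cone:
  assumes odd: "odd CARD('a::{field,finite})"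
  defines "S \<equiv> {x::'a^3. x \<noteq> 0 \<and> qform x = 0}" and "q \<equiv> real CARD('a)"
  shows "(q - 1) * (\<Sum>u\<in>S. \<Sum>v\<in>S. \<Sum>w\<in>S. of_bool (annihilator {u, v, w} \<noteq> {0}))
    = (q^2 - 1) * (q - 1)^3 + (q - 1) / 2 * ((q^2 + q) * (2 * (q - 1))^3)
      - (q^2 - q) * ((q - 1)^2 * (q^2 - 1))"
proof -
  define f where "f = (\<lambda>e::real. (q - e + q * e - 1)^3)"
  have card: "real (card S) = q^2 - 1"
    unfolding S_def q_def by (rule card_cone[OF odd])
  have h: "real (card {x\<in>S. scalar_product n x = 0})^3 = f (qchar (dual_qform n))" if "n \<noteq> 0" for n :: "'a^3"
  proof -
    have "real (card {x\<in>S. scalar_product n x = 0}) = real (card {x. qform x = 0 \<and> scalar_product n x = 0}) - 1"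
      using card_cone_restrict[of "\<lambda>x. scalar_product n x = 0"] by (simp add: S_def scalar_product_simps conj_assoc)
    also have "\<dots> = q - qchar (dual_qform n) + q * qchar (dual_qform n) - 1"
      using card_section[OF odd that, of 0 0] by (simp add: q_def)
    finally show ?thesis by (simp only: f_def)
  qed
  have h0: "real (card {x\<in>S. scalar_product 0 x = 0})^3 = real (card S)^3"
    by (simp add: scalar_product_simps)
  have "(\<Sum>n\<in>(UNIV::('a^3) set). real (card {x\<in>S. scalar_product n x = 0})^3) = real (card S)^3
    + (q^2 - 1) * f 0 + (q - 1) / 2 * ((q^2 + q) * f 1 + (q^2 - q) * f (-1))"
    unfolding q_def by (subst sum_over_normals[OF odd, where f = f]) (use h h0 in auto)
  moreover have "(\<Sum>u\<in>S. real (card {v\<in>S. \<exists>c. v = c *s u})^2) = (q - 1)^2 * real (card S)"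
  proof -
    have "real (card {v\<in>S. \<exists>c. v = c *s u}) = q - 1" if "u \<in> S" for u
      using that card_cone_multiples[of u] by (simp add: S_def q_def of_nat_diff Suc_leI)
    then show ?thesis by (simp add: mult.commute)
  qed
  moreover have "0 \<notin> S" by (simp add: S_def)
  moreover have "f 0 = (q - 1)^3" "f 1 = (2 * (q - 1))^3" "f (-1) = 0" by (simp_all add: f_def)
  moreover note dependent_triples[of S, folded q_def]
  ultimately show ?thesis
    by (simp only: card simp_thms) simp
qed

lemma sum_function_of_bool:
  fixes F :: "real \<Rightarrow> real"
  shows "(\<Sum>t\<in>(UNIV::'a::finite set). F (of_bool (P t)))
    = real CARD('a) * F 0 + (\<Sum>t\<in>UNIV. of_bool (P t)) * (F 1 - F 0)"
proof -
  have "(\<Sum>t\<in>(UNIV::'a set). F (of_bool (P t))) = (\<Sum>t\<in>UNIV. F 0 + of_bool (P t) * (F 1 - F 0))"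
    by (rule sum.cong) (auto simp: of_bool_def)
  then show ?thesis by (simp only: sum.distrib sum_distrib_right[symmetric]) simp
qed

text \<open>
  Here \<open>T\<close> is the number of points, \<open>L\<close> the number of points that are joined to a given one by a line on the
  quadric, and \<open>m e\<close> the sum of the fourth powers of the sizes of the sections by all parallel planes with
  a given normal vector whose dual form has character \<open>e\<close>. A proper secant contributes \<open>1 + 2 + 2\<^sup>2 = 7\<close> and a
  line on the quadric \<open>1 + q + q\<^sup>2\<close> by \<open>sum_on_line_differences\<close>.
\<close>

lemma coplanar_quadruples_quadric:
  fixes d :: "'a::{field,finite}"
  assumes odd: "odd CARD('a)" and d: "d \<noteq> 0"
  defines "S \<equiv> {x. qform x = d}" and "q \<equiv> real CARD('a)" and "\<epsilon> \<equiv> qchar d"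
  defines "T \<equiv> q^2 + q * \<epsilon>" and "L \<equiv> (q - 1) * (1 + \<epsilon>)"
    and "m \<equiv> \<lambda>e. q * (q - e)^4 + (1 + e * \<epsilon>) * ((q - e + q * e)^4 - (q - e)^4)"
  shows "(q - 1) * (\<Sum>x\<in>S. \<Sum>y\<in>S. \<Sum>z\<in>S. \<Sum>w\<in>S. of_bool (annihilator {y - x, z - x, w - x} \<noteq> {0}))
    = (q^2 - 1) * ((q - 1) * q^4 + (q * (1 + \<epsilon>))^4) + (q - 1) / 2 * ((q^2 + q) * m 1 + (q^2 - q) * m (-1))
      - (q^2 - q) * (T * (1 + (T - 1 - L) * 7 + L * (1 + q + q^2))) - (q^3 - q^2) * T"
proof -
  define f where "f = (\<lambda>e::real. if e = 0 then (q - 1) * q^4 + (q * (1 + \<epsilon>))^4 else m e)"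
  have card: "real (card S) = T"
    unfolding S_def q_def \<epsilon>_def T_def by (rule card_quadric[OF odd])
  have h: "(\<Sum>t\<in>UNIV. real (card {x\<in>S. scalar_product n x = t})^4) = f (qchar (dual_qform n))"
    if "n \<noteq> 0" for n :: "'a^3"
  proof -
    define D where "D = dual_qform n"
    \<comment> \<open>a degenerate section has \<open>q k\<close> points more than the other sections by parallel planes\<close>
    define k where "k = (if D = 0 then \<epsilon> else qchar D)"
    have "(\<Sum>t\<in>UNIV. real (card {x\<in>S. scalar_product n x = t})^4)
      = (\<Sum>t\<in>UNIV. (q - qchar D + q * k * of_bool (t^2 = D * d))^4)"
    proof (rule sum.cong[OF refl])
      fix t
      have "real (card {x\<in>S. scalar_product n x = t}) = q - qchar D + q * k * of_bool (D * d = t^2)"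
        unfolding S_def q_def D_def k_def \<epsilon>_def mem_Collect_eq by (rule card_section[OF odd that])
      then show "real (card {x\<in>S. scalar_product n x = t})^4 = (q - qchar D + q * k * of_bool (t^2 = D * d))^4"
        by (simp only: eq_commute[of "t^2"])
    qed
    also have "\<dots> = q * (q - qchar D)^4
        + (\<Sum>t\<in>(UNIV::'a set). of_bool (t^2 = D * d)) * ((q - qchar D + q * k)^4 - (q - qchar D)^4)"
      using sum_function_of_bool[of "\<lambda>b. (q - qchar D + q * k * b)^4" "\<lambda>t. t^2 = D * d"]
      by (simp only: q_def mult_zero_right mult_1_right add_0_right)
    also have "\<dots> = q * (q - qchar D)^4 + (1 + qchar D * \<epsilon>) * ((q - qchar D + q * k)^4 - (q - qchar D)^4)"
      by (simp only: count_square_roots[OF odd] qchar_mult[OF odd] \<epsilon>_def)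
    also have "\<dots> = f (qchar D)"
    proof (cases "D = 0")
      case True
      then show ?thesis by (simp add: f_def k_def algebra_simps)
    next
      case False
      then show ?thesis by (simp add: f_def k_def m_def)
    qed
    finally show ?thesis by (simp only: D_def)
  qed
  have h0: "(\<Sum>t\<in>UNIV. real (card {x\<in>S. scalar_product 0 x = t})^4) = T^4"
  proof -
    have "(\<Sum>t\<in>(UNIV::'a set). real (card {x\<in>S. scalar_product 0 x = t})^4)
      = (\<Sum>t\<in>(UNIV::'a set). if t = 0 then real (card S)^4 else 0)"
      by (rule sum.cong) (auto simp: scalar_product_simps)
    then show ?thesis by (simp add: card)
  qed
  have "(\<Sum>n\<in>(UNIV::('a^3) set). \<Sum>t\<in>UNIV. real (card {x\<in>S. scalar_product n x = t})^4) = T^4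
    + (q^2 - 1) * f 0 + (q - 1) / 2 * ((q^2 + q) * f 1 + (q^2 - q) * f (-1))"
    unfolding q_def by (subst sum_over_normals[OF odd, where f = f]) (use h h0 in auto)
  moreover have "(\<Sum>x\<in>S. 1 + (\<Sum>y\<in>S - {x}. 1 + real (card {z\<in>S. \<exists>c. z - x = c *s (y - x)})
      + real (card {z\<in>S. \<exists>c. z - x = c *s (y - x)})^2)) = T * (1 + (T - 1 - L) * 7 + L * (1 + q + q^2))"
  proof -
    have "1 + (\<Sum>y\<in>S - {x}. 1 + real (card {z\<in>S. \<exists>c. z - x = c *s (y - x)})
      + real (card {z\<in>S. \<exists>c. z - x = c *s (y - x)})^2) = 1 + (T - 1 - L) * 7 + L * (1 + q + q^2)"
      if x: "x \<in> S" for x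
    proof -
      have "(\<Sum>y\<in>S - {x}. 1 + real (card {z\<in>S. \<exists>c. z - x = c *s (y - x)})
        + real (card {z\<in>S. \<exists>c. z - x = c *s (y - x)})^2)
        = (\<Sum>y\<in>S - {x}. 7 + of_bool (qform (y - x) = 0) * (q^2 + q - 6))"
      proof (rule sum.cong[OF refl])
        fix y assume "y \<in> S - {x}"
        then have "card {z\<in>S. \<exists>c. z - x = c *s (y - x)} = (if qform (y - x) = 0 then CARD('a) else 2)"
          unfolding S_def using x by (intro card_quadric_secant) (auto simp: S_def)
        then show "1 + real (card {z\<in>S. \<exists>c. z - x = c *s (y - x)})
          + real (card {z\<in>S. \<exists>c. z - x = c *s (y - x)})^2 = 7 + of_bool (qform (y - x) = 0) * (q^2 + q - 6)"
          by (simp add: q_def)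
      qed
      also have "\<dots> = 7 * real (card (S - {x})) + (\<Sum>y\<in>S - {x}. of_bool (qform (y - x) = 0)) * (q^2 + q - 6)"
        by (simp only: sum.distrib sum_distrib_right[symmetric]) simp
      also have "(\<Sum>y\<in>S - {x}. of_bool (qform (y - x) = 0)) = L"
        using card_quadric_ruling[OF odd d, of x] x
        by (simp only: sum_of_bool_card finite S_def L_def q_def \<epsilon>_def mem_Collect_eq)
      also have "real (card (S - {x})) = T - 1"
      proof -
        have "card S > 0" using x card_gt_0_iff by fastforce
        then show ?thesis using x card by (simp add: card_Diff_singleton of_nat_diff Suc_leI)
      qed
      finally show ?thesis by (simp add: algebra_simps)
    qed
    then have "(\<Sum>x\<in>S. 1 + (\<Sum>y\<in>S - {x}. 1 + real (card {z\<in>S. \<exists>c. z - x = c *s (y - x)})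
      + real (card {z\<in>S. \<exists>c. z - x = c *s (y - x)})^2))
      = (\<Sum>x\<in>S. 1 + (T - 1 - L) * 7 + L * (1 + q + q^2))"
      by (rule sum.cong[OF refl])
    then show ?thesis by (simp only: sum_constant card)
  qed
  moreover have "f 0 = (q - 1) * q^4 + (q * (1 + \<epsilon>))^4" "f 1 = m 1" "f (-1) = m (-1)"
    by (simp_all add: f_def)
  moreover note coplanar_quadruples[of S, folded q_def]
  ultimately show ?thesis
    by (simp only: card)
qed

section \<open>Conjugacy classes as quadrics\<close>

lemma mat2_eq_iff: "A = B \<longleftrightarrow> A$1$1 = B$1$1 \<and> A$1$2 = B$1$2 \<and> A$2$1 = B$2$1 \<and> A$2$2 = B$2$2"
  for A B :: "'a^2^2"
  by (auto simp: vec_eq_iff forall_2)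

lemma mat2_mult_nth: "(A ** B)$i$j = A$i$1 * B$1$j + A$i$2 * B$2$j" for A B :: "'a::semiring_1^2^2"
  by (simp add: matrix_matrix_mult_def sum_2)

lemma trace_2: "trace A = A$1$1 + A$2$2" for A :: "'a::comm_ring_1^2^2"
  by (simp add: trace_def sum_2)

lemma mat2_nth: "(mat c :: 'a::zero^2^2)$1$1 = c" "(mat c :: 'a^2^2)$1$2 = 0"
  "(mat c :: 'a^2^2)$2$1 = 0" "(mat c :: 'a^2^2)$2$2 = c"
  by (simp_all add: mat_def)

lemma mat2_cayley_hamilton:
  fixes X :: "'a::field^2^2"
  shows "X ** X = scale_matrix (trace X) X - mat (det X)"
  by (simp add: mat2_eq_iff mat2_mult_nth scale_matrix_def trace_2 det_2 mat2_nth algebra_simps)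

lemma matrix_inv_inverse:
  fixes P :: "'a::field^'n^'n"
  assumes "invertible P"
  shows "P ** matrix_inv P = mat 1" "matrix_inv P ** P = mat 1"
proof -
  have "\<exists>Q. P ** Q = mat 1 \<and> Q ** P = mat 1" using assms by (simp add: invertible_def)
  then have "P ** matrix_inv P = mat 1 \<and> matrix_inv P ** P = mat 1"
    unfolding matrix_inv_def by (rule someI_ex)
  then show "P ** matrix_inv P = mat 1" "matrix_inv P ** P = mat 1" by simp_all
qed

lemma Orb_iff: "X \<in> Orb C \<longleftrightarrow> (\<exists>P. invertible P \<and> X ** P = P ** C)"
proof
  assume "X \<in> Orb C"
  then obtain P where P: "invertible P" "X = P ** C ** matrix_inv P" by (auto simp: Orb_def)
  then have "X ** P = P ** C" by (simp add: matrix_mul_assoc[symmetric] matrix_inv_inverse)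
  with P show "\<exists>P. invertible P \<and> X ** P = P ** C" by blast
next
  assume "\<exists>P. invertible P \<and> X ** P = P ** C"
  then obtain P where P: "invertible P" "X ** P = P ** C" by blast
  then have "P ** C ** matrix_inv P = X ** (P ** matrix_inv P)" by (simp add: matrix_mul_assoc)
  then have "X = P ** C ** matrix_inv P" using P by (simp add: matrix_inv_inverse)
  with P show "X \<in> Orb C" by (auto simp: Orb_def)
qed

text \<open>
  The matrix of \<open>X\<close> in a basis of the form \<open>v\<close>, \<open>X v\<close>.
\<close>

definition companion :: "'a::field^2^2 \<Rightarrow> 'a^2^2" where
  "companion X = (\<chi> i j. if j = 1 then (if i = 1 then 0 else 1) else (if i = 1 then - det X else trace X))"

text \<open>
  In the basis \<open>v\<close>, \<open>X v\<close> the matrix \<open>X\<close> becomes the companion matrix of its characteristic polynomial. If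
  \<open>v\<close> and \<open>X v\<close> were dependent for all three vectors \<open>(1, 0)\<close>, \<open>(0, 1)\<close> and \<open>(1, 1)\<close>, then all of them would
  be eigenvectors, and \<open>X\<close> would be scalar.
\<close>

lemma nonscalar_similar_companion:
  fixes X :: "'a::field^2^2"
  assumes X: "\<And>c. X \<noteq> mat c"
  shows "\<exists>P. invertible P \<and> X ** P = P ** companion X"
proof -
  \<comment> \<open>the matrix with columns \<open>(v, w)\<close> and \<open>X (v, w)\<close>\<close>
  define P :: "'a \<Rightarrow> 'a \<Rightarrow> 'a^2^2" where "P = (\<lambda>v w. \<chi> i j. if j = 1 then (if i = 1 then v else w)
      else X$i$1 * v + X$i$2 * w)"
  have P: "X ** P v w = P v w ** companion X" for v w
    by (simp add: mat2_eq_iff mat2_mult_nth P_def companion_def trace_2 det_2 algebra_simps)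
  have "det (P 1 0) \<noteq> 0 \<or> det (P 0 1) \<noteq> 0 \<or> det (P 1 1) \<noteq> 0"
  proof (rule ccontr)
    assume "\<not> ?thesis"
    then have "X$2$1 = 0" "X$1$2 = 0" "X$2$2 = X$1$1" by (auto simp: det_2 P_def)
    then have "X = mat (X$1$1)" by (simp add: mat2_eq_iff mat2_nth)
    then show False using X by blast
  qed
  then show ?thesis using P invertible_det_nz by blast
qed

text \<open>
  Non-scalar matrices with equal trace and determinant are similar to the same companion matrix, and
  conjugation changes neither of these nor turns a matrix into a scalar one.
\<close>

lemma Orb_eq_nonscalar:
  fixes C :: "'a::field^2^2"
  assumes C: "\<And>c. C \<noteq> mat c"
  shows "Orb C = {X. trace X = trace C \<and> det X = det C \<and> (\<forall>c. X \<noteq> mat c)}"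
proof (rule set_eqI, rule iffI)
  fix X assume "X \<in> Orb C"
  then obtain P where P: "invertible P" "X = P ** C ** matrix_inv P" by (auto simp: Orb_def)
  note inv = matrix_inv_inverse[OF P(1)]
  have "trace X = trace (matrix_inv P ** (P ** C))" unfolding P(2) by (rule trace_mul_sym)
  then have "trace X = trace C" by (simp add: matrix_mul_assoc inv)
  moreover have "det P * det (matrix_inv P) = 1"
    using arg_cong[OF inv(1), of det] by (simp add: det_mul)
  then have "det X = det C" unfolding P(2) by (simp add: det_mul)
  moreover have "X \<noteq> mat c" for c
  proof
    assume "X = mat c"
    moreover have "C = matrix_inv P ** X ** P"
      unfolding P(2) by (simp add: matrix_mul_assoc inv) (simp add: matrix_mul_assoc[symmetric] inv)
    moreover have "matrix_inv P ** mat c = mat c ** matrix_inv P"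
      by (simp add: mat2_eq_iff mat2_mult_nth mat2_nth mult.commute)
    ultimately have "C = mat c" by (simp add: matrix_mul_assoc[symmetric] inv)
    then show False using C by blast
  qed
  ultimately show "X \<in> {X. trace X = trace C \<and> det X = det C \<and> (\<forall>c. X \<noteq> mat c)}" by blast
next
  fix X :: "'a^2^2"
  assume X: "X \<in> {X. trace X = trace C \<and> det X = det C \<and> (\<forall>c. X \<noteq> mat c)}"
  then obtain P where P: "invertible P" "X ** P = P ** companion X"
    using nonscalar_similar_companion by blast
  obtain R where R: "invertible R" "C ** R = R ** companion C"
    using nonscalar_similar_companion C by blast
  have "trace X = trace C" "det X = det C" using X by blast+
  then have K: "companion X = companion C" unfolding companion_def by metis
  define Q where "Q = P ** matrix_inv R"
  note inv = matrix_inv_inverse[OF R(1)]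
  have "invertible (matrix_inv R)" using inv by (auto simp: invertible_def)
  then have "invertible Q" unfolding Q_def using P(1) by (rule invertible_mult[rotated])
  moreover have "companion C ** matrix_inv R = matrix_inv R ** C"
  proof -
    have "companion C ** matrix_inv R = matrix_inv R ** (R ** companion C) ** matrix_inv R"
      by (simp add: matrix_mul_assoc inv)
    also have "\<dots> = matrix_inv R ** C ** (R ** matrix_inv R)"
      unfolding R(2)[symmetric] by (simp add: matrix_mul_assoc)
    finally show ?thesis by (simp add: inv)
  qed
  then have "X ** Q = Q ** C"
    unfolding Q_def by (metis K P(2) matrix_mul_assoc)
  ultimately show "X \<in> Orb C" using Orb_iff by blast
qed

lemma cyclic_mat_nonscalar:
  assumes "cyclic_mat C"
  shows "C \<noteq> mat c"
proof
  assume C: "C = mat c"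
  obtain v where v: "v \<noteq> C *v v" "vec.independent {v, C *v v}"
    using assms by (auto simp: cyclic_mat_def)
  have "C *v v = c *s v"
    by (simp add: C vec_eq_iff matrix_vector_mult_def mat_def if_distrib[of "\<lambda>a. a * _"] cong: if_cong)
  moreover have "c *s v \<in> vec.span {v}" by (intro vec.span_scale vec.span_base) simp
  ultimately have "C *v v \<in> vec.span {v}" by simp
  moreover have "vec.independent (insert (C *v v) {v})" using v by (simp add: insert_commute)
  ultimately show False using v(1) by (auto simp: vec.independent_insert)
qed

definition traceless :: "'a::field^3 \<Rightarrow> 'a^2^2" where
  "traceless x = (\<chi> i j. if i = 1 then (if j = 1 then x$1 else x$2) else (if j = 1 then x$3 else - x$1))"

lemma traceless_nth:
  "traceless x$1$1 = x$1" "traceless x$1$2 = x$2" "traceless x$2$1 = x$3" "traceless x$2$2 = - x$1"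
  by (simp_all add: traceless_def)

lemma traceless_diff: "traceless (x - y) = traceless x - traceless y"
  by (simp add: mat2_eq_iff traceless_nth)

lemma inj_traceless: "inj traceless"
  by (auto simp: inj_def mat2_eq_iff traceless_nth vec_eq_iff forall_3)

lemma range_traceless: "range traceless = (sl2 :: ('a::field^2^2) set)"
proof (rule set_eqI, rule iffI)
  fix X :: "'a^2^2" assume "X \<in> sl2"
  then have "X = traceless (\<chi> i. if i = 1 then X$1$1 else if i = 2 then X$1$2 else X$2$1)"
    by (simp add: sl2_def mat2_eq_iff traceless_nth trace_2 eq_neg_iff_add_eq_0 add.commute)
  then show "X \<in> range traceless" by blast
qed (auto simp: sl2_def trace_2 traceless_nth)

lemma span_traceless_image:
  "mat_vs.span (traceless ` X) = sl2 \<longleftrightarrow> vec.span X = UNIV"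
proof -
  have "module_hom ((*s)) scale_matrix (traceless :: 'a::field^3 \<Rightarrow> 'a^2^2)"
    by unfold_locales (simp_all add: mat2_eq_iff traceless_nth scale_matrix_def algebra_simps)
  then have "mat_vs.span (traceless ` X) = traceless ` vec.span X"
    by (rule module_hom.span_image)
  then show ?thesis
    unfolding range_traceless[symmetric] by (simp only: inj_image_eq_iff[OF inj_traceless])
qed

text \<open>
  The origin corresponds to the scalar matrix \<open>h \<cdot> 1\<close>, which lies on the quadric for \<open>disc C = 0\<close>.
\<close>

lemma Orb_eq_quadric:
  fixes C :: "'a::{field,finite}^2^2"
  assumes odd: "odd CARD('a)" and C: "cyclic_mat C"
  defines "h \<equiv> trace C / 2"
  shows "Orb C = (\<lambda>x. mat h + traceless x) ` {x. x \<noteq> 0 \<and> qform x = disc C / 4}"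
proof -
  note two = odd_card_two_neq_0[OF odd] and four = odd_card_four_neq_0[OF odd]
  have nonscalar: "C \<noteq> mat c" for c by (rule cyclic_mat_nonscalar[OF C])
  have det: "det (mat h + traceless x) = h^2 - qform x" for x
    by (simp add: det_2 mat2_nth traceless_nth qform_def algebra_simps power2_eq_square)
  have tr: "trace (mat h + traceless x) = trace C" for x
    using two by (simp add: trace_2 mat2_nth traceless_nth h_def flip: mult_2)
  have d: "disc C / 4 = h^2 - det C"
    using two four by (simp add: disc_def h_def field_simps power2_eq_square)
  have scalar: "(\<exists>c. mat h + traceless x = mat c) \<longleftrightarrow> x = 0" for x
  proof
    assume "\<exists>c. mat h + traceless x = mat c"
    then have "x$2 = 0" "x$3 = 0" "h + x$1 = h - x$1"
      by (auto simp: mat2_eq_iff mat2_nth traceless_nth)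
    then have "2 * x$1 = 0" by (simp add: algebra_simps)
    then show "x = 0" using \<open>x$2 = 0\<close> \<open>x$3 = 0\<close> two by (simp add: vec_eq_iff forall_3)
  next
    assume "x = 0"
    then have "mat h + traceless x = mat h" by (simp add: mat2_eq_iff mat2_nth traceless_nth)
    then show "\<exists>c. mat h + traceless x = mat c" ..
  qed
  show ?thesis
    unfolding Orb_eq_nonscalar[OF nonscalar]
  proof (rule set_eqI, rule iffI)
    fix X :: "'a^2^2"
    assume X: "X \<in> {X. trace X = trace C \<and> det X = det C \<and> (\<forall>c. X \<noteq> mat c)}"
    have "trace (X - mat h) = trace X - 2 * h" by (simp add: trace_2 mat2_nth)
    also have "\<dots> = 0" using X two by (simp add: h_def)
    finally have "trace (X - mat h) = 0" .
    then obtain x where "X - mat h = traceless x" using range_traceless by (auto simp: sl2_def)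
    then have x: "X = mat h + traceless x" by (simp add: algebra_simps)
    then have "x \<noteq> 0" using X scalar by blast
    moreover have "qform x = disc C / 4" using X x det[of x] d by (simp add: algebra_simps)
    ultimately show "X \<in> (\<lambda>x. mat h + traceless x) ` {x. x \<noteq> 0 \<and> qform x = disc C / 4}"
      using x by blast
  next
    fix X :: "'a^2^2"
    assume "X \<in> (\<lambda>x. mat h + traceless x) ` {x. x \<noteq> 0 \<and> qform x = disc C / 4}"
    then obtain x where x: "X = mat h + traceless x" "x \<noteq> 0" "qform x = disc C / 4" by blast
    then have "det X = det C" using det[of x] d by simp
    moreover have "trace X = trace C" unfolding x(1) by (rule tr)
    moreover have "\<forall>c. X \<noteq> mat c" using scalar[of x] x(2) unfolding x(1) by simp
    ultimately show "X \<in> {X. trace X = trace C \<and> det X = det C \<and> (\<forall>c. X \<noteq> mat c)}"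
      by simp
  qed
qed

lemma charpoly_2: "charpoly C = [:det C, - trace C, 1:]" for C :: "'a::field^2^2"
  by (simp add: charpoly_def det_2 map_matrix_def mat2_nth trace_2 algebra_simps)

lemma poly_splits_charpoly_iff:
  fixes C :: "'a::field^2^2"
  assumes two: "(2::'a) \<noteq> 0"
  shows "poly_splits (charpoly C) \<longleftrightarrow> (\<exists>s. disc C = s^2)"
proof
  assume "poly_splits (charpoly C)"
  then obtain c as where p: "charpoly C = smult c (\<Prod>a\<leftarrow>as. [:- a, 1:])" by (auto simp: poly_splits_def)
  have "as \<noteq> []"
  proof
    assume "as = []"
    then have "charpoly C = [:c:]" using p by simp
    then show False by (simp add: charpoly_2)
  qed
  then obtain r rs where "as = r # rs" by (cases as) auto
  then have "poly (charpoly C) r = 0" using p by simp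
  then have det: "det C = r * trace C - r^2" by (simp add: charpoly_2 algebra_simps power2_eq_square)
  have "disc C = (2 * r - trace C)^2" unfolding disc_def det by (simp add: algebra_simps power2_eq_square)
  then show "\<exists>s. disc C = s^2" ..
next
  assume "\<exists>s. disc C = s^2"
  then obtain s where s: "disc C = s^2" ..
  have four: "(4::'a) \<noteq> 0" using two by (metis mult_eq_0_iff numeral_times_numeral semiring_norm(13) semiring_norm(11))
  define a b where "a = (trace C + s) / 2" and "b = (trace C - s) / 2"
  have "a + b = trace C" using two four by (simp add: a_def b_def field_simps)
  moreover have "a * b = det C"
  proof -
    have "4 * (a * b) = (trace C)^2 - s^2" using two four by (simp add: a_def b_def field_simps power2_eq_square)
    also have "\<dots> = 4 * det C" unfolding s[symmetric] disc_def by simp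
    finally show ?thesis using four by simp
  qed
  ultimately have "charpoly C = smult 1 (\<Prod>a\<leftarrow>[a, b]. [:- a, 1:])"
    by (simp add: charpoly_2 algebra_simps)
  then show "poly_splits (charpoly C)" unfolding poly_splits_def by blast
qed

lemma qchar_disc:
  fixes C :: "'a::{field,finite}^2^2"
  assumes odd: "odd CARD('a)"
  shows "split_mat C \<Longrightarrow> qchar (disc C / 4) = 1" and "nonsplit_mat C \<Longrightarrow> qchar (disc C / 4) = -1"
proof -
  note two = odd_card_two_neq_0[OF odd] and four = odd_card_four_neq_0[OF odd]
  have "disc C = 2^2 * (disc C / 4)" using four by simp
  then have "qchar (disc C / 4) = qchar (disc C)" using qchar_power2_mult[OF odd two] by metis
  then show "split_mat C \<Longrightarrow> qchar (disc C / 4) = 1" "nonsplit_mat C \<Longrightarrow> qchar (disc C / 4) = -1"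
    by (auto simp: split_mat_def nonsplit_mat_def regular_semisimple_def qchar_def
        poly_splits_charpoly_iff[OF two])
qed

text \<open>
  Nilpotency makes the determinant vanish, and then \<open>C\<^sup>2 = (trace C) C\<close> by Cayley-Hamilton, so the powers of \<open>C\<close>
  are multiples of \<open>C\<close> by powers of the trace.
\<close>

lemma nilpotent_mat_trace_det:
  fixes C :: "'a::field^2^2"
  assumes nil: "nilpotent_mat C" and C: "C \<noteq> 0"
  shows "trace C = 0" "det C = 0"
proof -
  obtain k where k: "(((**) C) ^^ k) (mat 1) = 0" using nil by (auto simp: nilpotent_mat_def)
  have "det ((((**) C) ^^ n) (mat 1)) = det C ^ n" for n
    by (induction n) (simp_all add: det_mul)
  then have "det C ^ k = 0" using k by (metis det_2 zero_index mult_zero_left diff_0_right)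
  then show det: "det C = 0" by simp
  have pow: "(((**) C) ^^ Suc n) (mat 1) = scale_matrix (trace C ^ n) C" for n
  proof (induction n)
    case 0
    show ?case by (simp add: mat2_eq_iff scale_matrix_def)
  next
    case (Suc n)
    have "(((**) C) ^^ Suc (Suc n)) (mat 1) = C ** scale_matrix (trace C ^ n) C" using Suc by simp
    also have "\<dots> = scale_matrix (trace C ^ n) (C ** C)"
      by (simp add: mat2_eq_iff mat2_mult_nth scale_matrix_def algebra_simps)
    also have "C ** C = scale_matrix (trace C) C"
      unfolding mat2_cayley_hamilton det by (simp add: mat2_eq_iff mat2_nth)
    also have "scale_matrix (trace C ^ n) \<dots> = scale_matrix (trace C ^ Suc n) C"
      by (simp add: mat2_eq_iff scale_matrix_def algebra_simps)
    finally show ?case .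
  qed
  have "k \<noteq> 0"
  proof
    assume "k = 0"
    then have "(mat 1 :: 'a^2^2)$1$1 = 0" using k by simp
    then show False by (simp add: mat2_nth)
  qed
  then obtain n where "scale_matrix (trace C ^ n) C = 0" using pow k by (metis not0_implies_Suc)
  then show "trace C = 0" using C by (auto simp: mat2_eq_iff scale_matrix_def)
qed

section \<open>Independent uniform families\<close>

text \<open>
  The event splits into the disjoint events that the family equals a given function \<open>f\<close>. By independence
  each of these has probability \<open>1 / card S ^ card I\<close> if \<open>f\<close> takes its values in \<open>S\<close>, and \<open>0\<close> otherwise.
\<close>

lemma iid_uniform_prob:
  fixes S :: "'b::finite set" and \<Phi> :: "(nat \<Rightarrow> 'b) \<Rightarrow> bool"
  assumes "prob_space M" and iid: "iid_uniform M S K I"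
    and I: "finite I" "I \<noteq> {}" and S: "S \<noteq> {}"
    and \<Phi>: "\<And>f. \<Phi> (restrict f I) = \<Phi> f"
  shows "\<P>(\<omega> in M. \<Phi> (\<lambda>i. K i \<omega>)) = real (card {f \<in> I \<rightarrow>\<^sub>E S. \<Phi> f}) / real (card S) ^ card I"
proof -
  interpret prob_space M by fact
  have indep: "indep_vars (\<lambda>_. count_space UNIV) K I"
    and distr: "\<And>i. i \<in> I \<Longrightarrow> distr M (count_space UNIV) (K i) = measure_pmf (pmf_of_set S)"
    using iid by (auto simp: iid_uniform_def)
  have meas: "K i \<in> measurable M (count_space UNIV)" if "i \<in> I" for i
    using indep that by (auto simp: indep_vars_def)
  define E where "E f = {\<omega> \<in> space M. \<forall>i\<in>I. K i \<omega> = f i}" for f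
  have E_inter: "E f = (\<Inter>i\<in>I. K i -` {f i} \<inter> space M)" for f
    using I by (auto simp: E_def)
  have one: "prob (K i -` {x} \<inter> space M) = of_bool (x \<in> S) / real (card S)" if "i \<in> I" for i x
  proof -
    have "prob (K i -` {x} \<inter> space M) = measure (distr M (count_space UNIV) (K i)) {x}"
      using meas[OF that] by (simp add: measure_distr)
    also have "\<dots> = pmf (pmf_of_set S) x" by (simp add: distr[OF that] pmf.rep_eq)
    finally show ?thesis using S by (simp add: indicator_def)
  qed
  have prob_E: "prob (E f) = (\<Prod>i\<in>I. of_bool (f i \<in> S) / real (card S))" for f
    unfolding E_inter using indep_varsD_finite[OF indep I(2,1), of "\<lambda>i. {f i}"] by (simp add: one)
  have E_sets: "E f \<in> events" for f
    unfolding E_inter using I meas by (intro sets.finite_INT) (auto intro: measurable_sets)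
  have Un: "{\<omega> \<in> space M. \<Phi> (\<lambda>i. K i \<omega>)} = (\<Union>f\<in>{f \<in> I \<rightarrow>\<^sub>E UNIV. \<Phi> f}. E f)"
  proof (rule set_eqI, rule iffI)
    fix \<omega> assume \<omega>: "\<omega> \<in> {\<omega> \<in> space M. \<Phi> (\<lambda>i. K i \<omega>)}"
    then have "\<Phi> (restrict (\<lambda>i. K i \<omega>) I)" using \<Phi> by simp
    then show "\<omega> \<in> (\<Union>f\<in>{f \<in> I \<rightarrow>\<^sub>E UNIV. \<Phi> f}. E f)"
      using \<omega> by (intro UN_I[of "restrict (\<lambda>i. K i \<omega>) I"]) (auto simp: E_def)
  next
    fix \<omega> assume "\<omega> \<in> (\<Union>f\<in>{f \<in> I \<rightarrow>\<^sub>E UNIV. \<Phi> f}. E f)"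
    then obtain f where f: "f \<in> I \<rightarrow>\<^sub>E UNIV" "\<Phi> f" "\<omega> \<in> E f" by blast
    then have "restrict (\<lambda>i. K i \<omega>) I = restrict f I" by (auto simp: E_def restrict_def)
    then have "\<Phi> (\<lambda>i. K i \<omega>)" using f \<Phi> by metis
    then show "\<omega> \<in> {\<omega> \<in> space M. \<Phi> (\<lambda>i. K i \<omega>)}" using f by (simp add: E_def)
  qed
  have fin: "finite (I \<rightarrow>\<^sub>E (UNIV :: 'b set))" using I by (intro finite_PiE) auto
  have disj: "disjoint_family_on E {f \<in> I \<rightarrow>\<^sub>E UNIV. \<Phi> f}"
    unfolding disjoint_family_on_def
  proof (intro ballI impI)
    fix f g assume fg: "f \<in> {f \<in> I \<rightarrow>\<^sub>E UNIV. \<Phi> f}" "g \<in> {f \<in> I \<rightarrow>\<^sub>E UNIV. \<Phi> f}" "f \<noteq> g"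
    show "E f \<inter> E g = {}"
    proof (rule ccontr)
      assume "E f \<inter> E g \<noteq> {}"
      then have "\<forall>i\<in>I. f i = g i" by (auto simp: E_def)
      then have "f = g" using fg by (intro PiE_ext[of f I "\<lambda>_. UNIV" g]) auto
      then show False using fg by simp
    qed
  qed
  have "prob {\<omega> \<in> space M. \<Phi> (\<lambda>i. K i \<omega>)} = (\<Sum>f\<in>{f \<in> I \<rightarrow>\<^sub>E UNIV. \<Phi> f}. prob (E f))"
    unfolding Un using fin disj E_sets by (intro finite_measure_finite_Union) auto
  also have "\<dots> = (\<Sum>f\<in>{f \<in> I \<rightarrow>\<^sub>E S. \<Phi> f}. prob (E f))"
  proof (rule sum.mono_neutral_right)
    show "finite {f \<in> I \<rightarrow>\<^sub>E (UNIV::'b set). \<Phi> f}" using fin by simp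
    show "\<forall>f\<in>{f \<in> I \<rightarrow>\<^sub>E UNIV. \<Phi> f} - {f \<in> I \<rightarrow>\<^sub>E S. \<Phi> f}. prob (E f) = 0"
    proof
      fix f assume "f \<in> {f \<in> I \<rightarrow>\<^sub>E UNIV. \<Phi> f} - {f \<in> I \<rightarrow>\<^sub>E S. \<Phi> f}"
      then obtain i where "i \<in> I" "f i \<notin> S" by (auto simp: PiE_iff)
      then show "prob (E f) = 0" unfolding prob_E using I by (auto intro!: prod_zero)
    qed
  qed auto
  also have "\<dots> = (\<Sum>f\<in>{f \<in> I \<rightarrow>\<^sub>E S. \<Phi> f}. (1 / real (card S)) ^ card I)"
  proof (rule sum.cong[OF refl])
    fix f assume "f \<in> {f \<in> I \<rightarrow>\<^sub>E S. \<Phi> f}"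
    then have "prob (E f) = (\<Prod>i\<in>I. 1 / real (card S))"
      unfolding prob_E by (intro prod.cong) auto
    then show "prob (E f) = (1 / real (card S)) ^ card I" by simp
  qed
  finally show ?thesis by (simp add: power_divide)
qed

lemma sum_PiE_3:
  fixes g :: "'b \<Rightarrow> 'b \<Rightarrow> 'b \<Rightarrow> real"
  shows "(\<Sum>f\<in>{1..3::nat} \<rightarrow>\<^sub>E S. g (f 1) (f 2) (f 3)) = (\<Sum>x\<in>S. \<Sum>y\<in>S. \<Sum>z\<in>S. g x y z)"
proof -
  have I: "{1..3::nat} = {1, 2, 3}" by auto
  have "(\<Sum>f\<in>{1..3::nat} \<rightarrow>\<^sub>E S. g (f 1) (f 2) (f 3)) = (\<Sum>(x,y,z)\<in>S \<times> S \<times> S. g x y z)"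
    by (rule sum.reindex_bij_witness[of _
          "\<lambda>(x,y,z). (\<lambda>i. if i = 1 then x else if i = 2 then y else if i = 3 then z else undefined)"
          "\<lambda>f. (f 1, f 2, f 3)"])
      (auto simp: I PiE_iff extensional_def fun_eq_iff)
  then show ?thesis by (simp only: sum.cartesian_product)
qed

lemma sum_PiE_4:
  fixes g :: "'b \<Rightarrow> 'b \<Rightarrow> 'b \<Rightarrow> 'b \<Rightarrow> real"
  shows "(\<Sum>f\<in>{1..4::nat} \<rightarrow>\<^sub>E S. g (f 1) (f 2) (f 3) (f 4)) = (\<Sum>x\<in>S. \<Sum>y\<in>S. \<Sum>z\<in>S. \<Sum>w\<in>S. g x y z w)"
proof -
  have I: "{1..4::nat} = {1, 2, 3, 4}" by auto
  have "(\<Sum>f\<in>{1..4::nat} \<rightarrow>\<^sub>E S. g (f 1) (f 2) (f 3) (f 4)) = (\<Sum>(x,y,z,w)\<in>S \<times> S \<times> S \<times> S. g x y z w)"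
    by (rule sum.reindex_bij_witness[of _
          "\<lambda>(x,y,z,w). (\<lambda>i. if i = 1 then x else if i = 2 then y else if i = 3 then z else if i = 4 then w else undefined)"
          "\<lambda>f. (f 1, f 2, f 3, f 4)"])
      (auto simp: I PiE_iff extensional_def fun_eq_iff)
  then show ?thesis by (simp only: sum.cartesian_product)
qed

lemma linearly_saturated_traceless:
  fixes x y z :: "'a::{field,finite}^3"
  assumes "K 1 = traceless x" "K 2 = traceless y" "K 3 = traceless z"
  shows "linearly_saturated 3 K \<longleftrightarrow> annihilator {x, y, z} = {0}"
proof -
  have I: "{1..3::nat} = {1, 2, 3}" by auto
  have "{K i | i. i \<in> {1..3}} = traceless ` {x, y, z}"
    by (simp only: Setcompr_eq_image I image_insert image_empty assms)
  then show ?thesis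
    unfolding linearly_saturated_def by (simp only: span_traceless_image span_UNIV_iff_annihilator)
qed

lemma affinely_saturated_traceless:
  fixes x y z w :: "'a::{field,finite}^3"
  assumes "K 1 = A + traceless x" "K 2 = A + traceless y" "K 3 = A + traceless z" "K 4 = A + traceless w"
  shows "affinely_saturated 4 K \<longleftrightarrow> annihilator {y - x, z - x, w - x} = {0}"
proof -
  have I: "{2..4::nat} = {2, 3, 4}" by auto
  have "{K i - K 1 | i. i \<in> {2..4}} = {K 2 - K 1, K 3 - K 1, K 4 - K 1}"
    by (simp only: Setcompr_eq_image I image_insert image_empty)
  also have "\<dots> = traceless ` {y - x, z - x, w - x}" unfolding assms by (simp add: traceless_diff)
  finally show ?thesis
    unfolding affinely_saturated_def by (simp only: span_traceless_image span_UNIV_iff_annihilator)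
qed

lemma prob_linearly_saturated:
  fixes S :: "('a::{field,finite}^3) set"
  assumes M: "prob_space M" and iid: "iid_uniform M (traceless ` S) K {1..3}" and S: "S \<noteq> {}"
  shows "\<P>(\<omega> in M. linearly_saturated 3 (\<lambda>i. K i \<omega>))
    = (real (card S)^3 - (\<Sum>x\<in>S. \<Sum>y\<in>S. \<Sum>z\<in>S. of_bool (annihilator {x, y, z} \<noteq> {0}))) / real (card S)^3"
proof -
  let ?O = "traceless ` S"
  let ?g = "\<lambda>X Y Z. of_bool (linearly_saturated 3 (\<lambda>i. if i = 1 then X else if i = 2 then Y else Z)) :: real"
  have cong: "linearly_saturated 3 f = linearly_saturated 3 g" if "\<And>i. i \<in> {1..3} \<Longrightarrow> f i = g i"
    for f g :: "nat \<Rightarrow> 'a^2^2"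
  proof -
    have "{f i | i. i \<in> {1..3}} = {g i | i. i \<in> {1..3}}" using that by (metis (no_types, lifting))
    then show ?thesis by (simp only: linearly_saturated_def)
  qed
  have card: "card ?O = card S" by (intro card_image inj_on_subset[OF inj_traceless]) simp
  have "real (card {f \<in> {1..3} \<rightarrow>\<^sub>E ?O. linearly_saturated 3 f})
    = (\<Sum>f\<in>{1..3} \<rightarrow>\<^sub>E ?O. of_bool (linearly_saturated 3 f))"
    by (subst sum_of_bool_card) (auto intro: finite_PiE)
  also have "\<dots> = (\<Sum>f\<in>{1..3::nat} \<rightarrow>\<^sub>E ?O. ?g (f 1) (f 2) (f 3))"
    by (intro sum.cong refl arg_cong[of _ _ of_bool] cong) (auto simp: le_Suc_eq numeral_eq_Suc)
  also have "\<dots> = (\<Sum>X\<in>?O. \<Sum>Y\<in>?O. \<Sum>Z\<in>?O. ?g X Y Z)" by (rule sum_PiE_3)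
  also have "\<dots> = (\<Sum>x\<in>S. \<Sum>y\<in>S. \<Sum>z\<in>S. ?g (traceless x) (traceless y) (traceless z))"
    by (simp only: sum.reindex[OF inj_on_subset[OF inj_traceless subset_UNIV]] o_def)
  also have "\<dots> = (\<Sum>x\<in>S. \<Sum>y\<in>S. \<Sum>z\<in>S. 1 - of_bool (annihilator {x, y, z} \<noteq> {0}))"
    by (intro sum.cong refl, subst linearly_saturated_traceless) auto
  also have "\<dots> = real (card S)^3 - (\<Sum>x\<in>S. \<Sum>y\<in>S. \<Sum>z\<in>S. of_bool (annihilator {x, y, z} \<noteq> {0}))"
    by (simp only: sum_subtractf) (simp add: power3_eq_cube)
  finally have count: "real (card {f \<in> {1..3} \<rightarrow>\<^sub>E ?O. linearly_saturated 3 f}) = \<dots>" .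
  have "\<P>(\<omega> in M. linearly_saturated 3 (\<lambda>i. K i \<omega>))
    = real (card {f \<in> {1..3} \<rightarrow>\<^sub>E ?O. linearly_saturated 3 f}) / real (card ?O) ^ card {1..3::nat}"
    by (rule iid_uniform_prob[OF M iid]) (use S in \<open>auto intro!: cong\<close>)
  then show ?thesis unfolding count card by simp
qed

lemma prob_affinely_saturated:
  fixes S :: "('a::{field,finite}^3) set"
  assumes M: "prob_space M" and iid: "iid_uniform M ((\<lambda>x. A + traceless x) ` S) K {1..4}" and S: "S \<noteq> {}"
  shows "\<P>(\<omega> in M. affinely_saturated 4 (\<lambda>i. K i \<omega>))
    = (real (card S)^4 - (\<Sum>x\<in>S. \<Sum>y\<in>S. \<Sum>z\<in>S. \<Sum>w\<in>S. of_bool (annihilator {y - x, z - x, w - x} \<noteq> {0})))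
      / real (card S)^4"
proof -
  let ?e = "\<lambda>x. A + traceless x"
  let ?O = "?e ` S"
  let ?g = "\<lambda>X Y Z W. of_bool (affinely_saturated 4
      (\<lambda>i. if i = 1 then X else if i = 2 then Y else if i = 3 then Z else W)) :: real"
  have inj: "inj_on ?e B" for B using inj_traceless by (auto simp: inj_on_def)
  have cong: "affinely_saturated 4 f = affinely_saturated 4 g" if "\<And>i. i \<in> {1..4} \<Longrightarrow> f i = g i"
    for f g :: "nat \<Rightarrow> 'a^2^2"
  proof -
    have "f 1 = g 1" "\<And>i. i \<in> {2..4} \<Longrightarrow> f i = g i" using that by auto
    then have "{f i - f 1 | i. i \<in> {2..4}} = {g i - g 1 | i. i \<in> {2..4}}" by (metis (no_types, lifting))
    then show ?thesis by (simp only: affinely_saturated_def)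
  qed
  have card: "card ?O = card S" by (rule card_image[OF inj])
  have "real (card {f \<in> {1..4} \<rightarrow>\<^sub>E ?O. affinely_saturated 4 f})
    = (\<Sum>f\<in>{1..4} \<rightarrow>\<^sub>E ?O. of_bool (affinely_saturated 4 f))"
    by (subst sum_of_bool_card) (auto intro: finite_PiE)
  also have "\<dots> = (\<Sum>f\<in>{1..4::nat} \<rightarrow>\<^sub>E ?O. ?g (f 1) (f 2) (f 3) (f 4))"
    by (intro sum.cong refl arg_cong[of _ _ of_bool] cong) (auto simp: le_Suc_eq numeral_eq_Suc)
  also have "\<dots> = (\<Sum>X\<in>?O. \<Sum>Y\<in>?O. \<Sum>Z\<in>?O. \<Sum>W\<in>?O. ?g X Y Z W)" by (rule sum_PiE_4)
  also have "\<dots> = (\<Sum>x\<in>S. \<Sum>y\<in>S. \<Sum>z\<in>S. \<Sum>w\<in>S. ?g (?e x) (?e y) (?e z) (?e w))"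
    by (simp only: sum.reindex[OF inj] o_def)
  also have "\<dots> = (\<Sum>x\<in>S. \<Sum>y\<in>S. \<Sum>z\<in>S. \<Sum>w\<in>S. 1 - of_bool (annihilator {y - x, z - x, w - x} \<noteq> {0}))"
    by (intro sum.cong refl, subst affinely_saturated_traceless) auto
  also have "\<dots> = real (card S)^4
      - (\<Sum>x\<in>S. \<Sum>y\<in>S. \<Sum>z\<in>S. \<Sum>w\<in>S. of_bool (annihilator {y - x, z - x, w - x} \<noteq> {0}))"
    by (simp only: sum_subtractf) (simp add: power4_eq_xxxx mult.assoc)
  finally have count: "real (card {f \<in> {1..4} \<rightarrow>\<^sub>E ?O. affinely_saturated 4 f}) = \<dots>" .
  have "\<P>(\<omega> in M. affinely_saturated 4 (\<lambda>i. K i \<omega>))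
    = real (card {f \<in> {1..4} \<rightarrow>\<^sub>E ?O. affinely_saturated 4 f}) / real (card ?O) ^ card {1..4::nat}"
    by (rule iid_uniform_prob[OF M iid]) (use S in \<open>auto intro!: cong\<close>)
  then show ?thesis unfolding count card by simp
qed

section \<open>The probabilities\<close>

text \<open>
  Clears the denominators \<open>q - 1\<close> and \<open>2\<close>, so that what remains of the arithmetic is one polynomial
  identity in \<open>q\<close>.
\<close>

lemma complement_count:
  fixes q N :: real
  assumes q: "q > 1" and N: "(q - 1) * N = A + (q - 1) / 2 * X - B"
    and G: "2 * (q - 1) * T - (2 * A + (q - 1) * X - 2 * B) = 2 * (q - 1) * G"
  shows "T - N = G"
proof -
  have "2 * ((q - 1) * N) = 2 * A + (q - 1) * X - 2 * B" unfolding N by simp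
  then have "(q - 1) * (T - N) = (q - 1) * G" using G by (simp add: algebra_simps)
  then show ?thesis using q by simp
qed

lemma linear_split_ratio:
  fixes q N :: real assumes q: "q > 1"
  and N: "(q - 1) * N = (q^2 - 1) * (q * (1 + 1))^3 + (q - 1) / 2 * ((q^2 + q) * (q - 1)^3 + (q^2 - q) * (q + 1)^3)
      - (q^2 - q) * (4 * (q^2 + q * 1))"
  shows "((q^2+q*1)^3 - N) / (q^2+q*1)^3 = (q - 1) * (q^3 + 2 * q^2 - 4 * q - 1) / (q^2 * (q + 1)^2)"
proof -
  have *: "(q^2+q*1)^3 - N = (q * (q + 1)) * ((q - 1) * (q^3 + 2 * q^2 - 4 * q - 1))"
    by (rule complement_count[OF q N]) algebra
  have T: "(q^2+q*1)^3 = (q * (q + 1)) * (q^2 * (q+1)^2)" by algebra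
  show ?thesis unfolding * unfolding T using q by (intro mult_divide_mult_cancel_left) auto
qed

lemma linear_nonsplit_ratio:
  fixes q N :: real assumes q: "q > 1"
  and N: "(q - 1) * N = (q^2 - 1) * (q * (1 + -1))^3 + (q - 1) / 2 * ((q^2 + q) * (q - 1)^3 + (q^2 - q) * (q + 1)^3)
      - (q^2 - q) * (4 * (q^2 + q * -1))"
  shows "((q^2+q * -1)^3 - N) / (q^2+q * -1)^3 = (q + 1) * (q^2 - 3 * q + 1) / (q^2 * (q - 1))"
proof -
  have N': "(q - 1) * N = 0 + (q - 1) / 2 * ((q^2 + q) * (q - 1)^3 + (q^2 - q) * (q + 1)^3)
      - (q^2 - q) * (4 * (q^2 - q))"
    using N by simp
  have *: "(q^2 - q)^3 - N = (q * (q - 1)^2) * ((q + 1) * (q^2 - 3 * q + 1))"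
    by (rule complement_count[OF q N']) algebra
  have T: "(q^2 - q)^3 = (q * (q - 1)^2) * (q^2 * (q - 1))" by algebra
  have E: "q^2 + q * -1 = q^2 - q" by simp
  show ?thesis unfolding E * unfolding T using q by (intro mult_divide_mult_cancel_left) auto
qed

lemma linear_nilpotent_ratio:
  fixes q N :: real assumes q: "q > 1"
  and N: "(q - 1) * N = (q^2 - 1) * (q - 1)^3 + (q - 1) / 2 * ((q^2 + q) * (2 * (q - 1))^3)
      - (q^2 - q) * ((q - 1)^2 * (q^2 - 1))"
  shows "((q^2 - 1)^3 - N) / (q^2 - 1)^3 = q * (q - 1) / (q + 1)^2"
proof -
  have *: "(q^2 - 1)^3 - N = ((q - 1)^3 * (q + 1)) * (q * (q - 1))"
    by (rule complement_count[OF q N]) algebra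
  have T: "(q^2 - 1)^3 = ((q - 1)^3 * (q + 1)) * (q + 1)^2" by algebra
  show ?thesis unfolding * unfolding T using q by (intro mult_divide_mult_cancel_left) auto
qed

lemma affine_split_ratio:
  fixes q N e :: real
  defines "T \<equiv> q^2 + q * e" and "L \<equiv> (q - 1) * (1 + e)"
    and "m \<equiv> \<lambda>x. q * (q - x)^4 + (1 + x * e) * ((q - x + q * x)^4 - (q - x)^4)"
  assumes q: "q > 1" and e: "e = 1"
  and N: "(q - 1) * N = (q^2 - 1) * ((q - 1) * q^4 + (q * (1 + e))^4) + (q - 1) / 2 * ((q^2 + q) * m 1 + (q^2 - q) * m (-1))
      - (q^2 - q) * (T * (1 + (T - 1 - L) * 7 + L * (1 + q + q^2))) - (q^3 - q^2) * T"
  shows "(T^4 - N) / T^4 = (q - 1) / (q^2 * (q + 1)^3) * (q^4 + 3 * q^3 - 7 * q^2 + 11 * q - 10)"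
proof -
  have N': "(q - 1) * N = (q^2 - 1) * ((q - 1) * q^4 + (q * (1 + e))^4) + (q - 1) / 2 * ((q^2 + q) * m 1 + (q^2 - q) * m (-1))
      - ((q^2 - q) * (T * (1 + (T - 1 - L) * 7 + L * (1 + q + q^2))) + (q^3 - q^2) * T)"
    using N by simp
  have *: "T^4 - N = (q^2 * (q + 1)) * ((q - 1) * (q^4 + 3 * q^3 - 7 * q^2 + 11 * q - 10))"
    by (rule complement_count[OF q N'], unfold m_def T_def L_def e) algebra
  have T: "T^4 = (q^2 * (q + 1)) * (q^2 * (q + 1)^3)" unfolding T_def e by algebra
  show ?thesis unfolding * unfolding T times_divide_eq_left using q by (intro mult_divide_mult_cancel_left) auto
qed

lemma affine_nonsplit_ratio:
  fixes q N e :: real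
  defines "T \<equiv> q^2 + q * e" and "L \<equiv> (q - 1) * (1 + e)"
    and "m \<equiv> \<lambda>x. q * (q - x)^4 + (1 + x * e) * ((q - x + q * x)^4 - (q - x)^4)"
  assumes q: "q > 1" and e: "e = -1"
  and N: "(q - 1) * N = (q^2 - 1) * ((q - 1) * q^4 + (q * (1 + e))^4) + (q - 1) / 2 * ((q^2 + q) * m 1 + (q^2 - q) * m (-1))
      - (q^2 - q) * (T * (1 + (T - 1 - L) * 7 + L * (1 + q + q^2))) - (q^3 - q^2) * T"
  shows "(T^4 - N) / T^4 = (q - 2) * (q + 1) * (q^2 - 2 * q - 1) / (q^2 * (q - 1)^2)"
proof -
  have *: "T = q^2 - q" "L = 0" "m 1 = q * (q - 1)^4" "m (-1) = q * (q + 1)^4 + 2 * (1 - (q + 1)^4)"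
    by (simp_all add: T_def L_def m_def e)
  have N': "(q - 1) * N = (q^2 - 1) * ((q - 1) * q^4)
      + (q - 1) / 2 * ((q^2 + q) * (q * (q - 1)^4) + (q^2 - q) * (q * (q + 1)^4 + 2 * (1 - (q + 1)^4)))
      - ((q^2 - q) * ((q^2 - q) * (1 + (q^2 - q - 1) * 7)) + (q^3 - q^2) * (q^2 - q))"
    using N unfolding * e by simp
  have D: "(q^2 - q)^4 - N = (q^2 * (q - 1)^2) * ((q - 2) * (q + 1) * (q^2 - 2 * q - 1))"
    by (rule complement_count[OF q N']) algebra
  have T: "(q^2 - q)^4 = (q^2 * (q - 1)^2) * (q^2 * (q - 1)^2)" by algebra
  show ?thesis unfolding *(1) D unfolding T using q by (intro mult_divide_mult_cancel_left) auto
qed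

theorem theorem8p2:
  fixes C :: "'a::{field,finite}^2^2"
    and q :: nat and \<tau> \<nu> \<Delta> :: 'a
    and M :: "'w measure" and K :: "nat \<Rightarrow> 'w \<Rightarrow> 'a^2^2"
  assumes "q = CARD('a)" and "odd q"
    and "cyclic_mat C"
    and "\<tau> = trace C" and "\<nu> = det C" and "\<Delta> = \<tau>^2 - 4 * \<nu>"
    and "prob_space M"
  shows
    "(\<tau> \<noteq> 0 \<and> \<Delta> \<noteq> 0 \<and> iid_uniform M (Orb C) K {1..4} \<longrightarrow>
        (split_mat C \<longrightarrow>
           \<P>(\<omega> in M. affinely_saturated 4 (\<lambda>i. K i \<omega>))
             = (real q - 1) / (real q^2 * (real q + 1)^3)
               * (real q^4 + 3 * real q^3 - 7 * real q^2 + 11 * real q - 10)) \<and>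
        (nonsplit_mat C \<longrightarrow>
           \<P>(\<omega> in M. affinely_saturated 4 (\<lambda>i. K i \<omega>))
             = (real q - 2) * (real q + 1) * (real q^2 - 2 * real q - 1)
               / (real q^2 * (real q - 1)^2))) \<and>
     (\<tau> = 0 \<and> \<nu> \<noteq> 0 \<and> iid_uniform M (Orb C) K {1..3} \<longrightarrow>
        (split_mat C \<longrightarrow>
           \<P>(\<omega> in M. linearly_saturated 3 (\<lambda>i. K i \<omega>))
             = (real q - 1) * (real q^3 + 2 * real q^2 - 4 * real q - 1)
               / (real q^2 * (real q + 1)^2)) \<and>
        (nonsplit_mat C \<longrightarrow>
           \<P>(\<omega> in M. linearly_saturated 3 (\<lambda>i. K i \<omega>))
             = (real q + 1) * (real q^2 - 3 * real q + 1)
               / (real q^2 * (real q - 1)))) \<and>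
     (C \<noteq> 0 \<and> nilpotent_mat C \<and> iid_uniform M (Orb C) K {1..3} \<longrightarrow>
        \<P>(\<omega> in M. linearly_saturated 3 (\<lambda>i. K i \<omega>))
          = real q * (real q - 1) / (real q + 1)^2)"
proof -
  let ?q = "real CARD('a)"
  define d where "d = disc C / 4"
  have odd: "odd CARD('a)" using assms(1,2) by simp
  have q: "?q > 1" using card_mono[of UNIV "{0, 1 :: 'a}"] by simp
  have card: "real (card {x. qform x = d}) = ?q^2 + ?q * qchar d" by (rule card_quadric[OF odd])
  have ne: "{x. qform x = d} \<noteq> {}" if "qchar d = 1 \<or> qchar d = -1"
  proof
    assume "{x. qform x = d} = {}"
    then have "?q * (?q + qchar d) = 0" using card by (simp add: algebra_simps power2_eq_square)
    moreover have "?q + qchar d > 0" using that q by linarith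
    ultimately show False using q by (simp only: mult_eq_0_iff) linarith
  qed
  have Orb: "Orb C = (\<lambda>x. mat (trace C / 2) + traceless x) ` {x. x \<noteq> 0 \<and> qform x = d}"
    unfolding d_def by (rule Orb_eq_quadric[OF odd assms(3)])
  have S: "{x. x \<noteq> 0 \<and> qform x = d} = {x. qform x = d}" if "qchar d = 1 \<or> qchar d = -1"
    using that by auto
  have aff: "\<P>(\<omega> in M. affinely_saturated 4 (\<lambda>i. K i \<omega>))
      = ((?q^2 + ?q * qchar d)^4 - (\<Sum>x\<in>{x. qform x = d}. \<Sum>y\<in>{x. qform x = d}. \<Sum>z\<in>{x. qform x = d}.
          \<Sum>w\<in>{x. qform x = d}. of_bool (annihilator {y - x, z - x, w - x} \<noteq> {0}))) / (?q^2 + ?q * qchar d)^4"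
    if "iid_uniform M (Orb C) K {1..4}" and \<epsilon>: "qchar d = 1 \<or> qchar d = -1"
  proof -
    have "iid_uniform M ((\<lambda>x. mat (trace C / 2) + traceless x) ` {x. qform x = d}) K {1..4}"
      using that(1) unfolding Orb S[OF \<epsilon>] .
    then show ?thesis unfolding card[symmetric] by (rule prob_affinely_saturated[OF assms(7) _ ne[OF \<epsilon>]])
  qed
  have Orb0: "Orb C = traceless ` {x. x \<noteq> 0 \<and> qform x = d}" if "trace C = 0"
    unfolding Orb that by (simp add: mat_0)
  have lin: "\<P>(\<omega> in M. linearly_saturated 3 (\<lambda>i. K i \<omega>))
      = ((?q^2 + ?q * qchar d)^3 - (\<Sum>x\<in>{x. qform x = d}. \<Sum>y\<in>{x. qform x = d}. \<Sum>z\<in>{x. qform x = d}.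
          of_bool (annihilator {x, y, z} \<noteq> {0}))) / (?q^2 + ?q * qchar d)^3"
    if "\<tau> = 0" and "iid_uniform M (Orb C) K {1..3}" and \<epsilon>: "qchar d = 1 \<or> qchar d = -1"
  proof -
    have "trace C = 0" using that(1) assms(4) by simp
    then have "iid_uniform M (traceless ` {x. qform x = d}) K {1..3}"
      using that(2) Orb0 S[OF \<epsilon>] by simp
    then show ?thesis unfolding card[symmetric] by (rule prob_linearly_saturated[OF assms(7) _ ne[OF \<epsilon>]])
  qed
  show ?thesis
  proof (intro conjI impI)
    assume "\<tau> \<noteq> 0 \<and> \<Delta> \<noteq> 0 \<and> iid_uniform M (Orb C) K {1..4}" "split_mat C"
    moreover from this have e: "qchar d = 1" using qchar_disc(1)[OF odd] by (simp add: d_def)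
    moreover have "d \<noteq> 0" using e by auto
    ultimately show "\<P>(\<omega> in M. affinely_saturated 4 (\<lambda>i. K i \<omega>))
             = (real q - 1) / (real q^2 * (real q + 1)^3)
               * (real q^4 + 3 * real q^3 - 7 * real q^2 + 11 * real q - 10)"
      using affine_split_ratio[OF q e coplanar_quadruples_quadric[OF odd]] aff assms(1) by simp
  next
    assume "\<tau> \<noteq> 0 \<and> \<Delta> \<noteq> 0 \<and> iid_uniform M (Orb C) K {1..4}" "nonsplit_mat C"
    moreover from this have e: "qchar d = -1" using qchar_disc(2)[OF odd] by (simp add: d_def)
    moreover have "d \<noteq> 0" using e by auto
    ultimately show "\<P>(\<omega> in M. affinely_saturated 4 (\<lambda>i. K i \<omega>))
             = (real q - 2) * (real q + 1) * (real q^2 - 2 * real q - 1)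
               / (real q^2 * (real q - 1)^2)"
      using affine_nonsplit_ratio[OF q e coplanar_quadruples_quadric[OF odd]] aff assms(1) by simp
  next
    assume "\<tau> = 0 \<and> \<nu> \<noteq> 0 \<and> iid_uniform M (Orb C) K {1..3}" "split_mat C"
    moreover from this have e: "qchar d = 1" using qchar_disc(1)[OF odd] by (simp add: d_def)
    moreover have d: "d \<noteq> 0" using e by auto
    ultimately show "\<P>(\<omega> in M. linearly_saturated 3 (\<lambda>i. K i \<omega>))
             = (real q - 1) * (real q^3 + 2 * real q^2 - 4 * real q - 1)
               / (real q^2 * (real q + 1)^2)"
      using linear_split_ratio[OF q dependent_triples_quadric[OF odd d, unfolded e]] lin assms(1) by simp
  next
    assume "\<tau> = 0 \<and> \<nu> \<noteq> 0 \<and> iid_uniform M (Orb C) K {1..3}" "nonsplit_mat C"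
    moreover from this have e: "qchar d = -1" using qchar_disc(2)[OF odd] by (simp add: d_def)
    moreover have d: "d \<noteq> 0" using e by auto
    ultimately show "\<P>(\<omega> in M. linearly_saturated 3 (\<lambda>i. K i \<omega>))
             = (real q + 1) * (real q^2 - 3 * real q + 1)
               / (real q^2 * (real q - 1))"
      using linear_nonsplit_ratio[OF q dependent_triples_quadric[OF odd d, unfolded e]] lin assms(1) by simp
  next
    assume nil: "C \<noteq> 0 \<and> nilpotent_mat C \<and> iid_uniform M (Orb C) K {1..3}"
    then have "trace C = 0" "det C = 0" using nilpotent_mat_trace_det by blast+
    then have d: "d = 0" and cone: "Orb C = traceless ` {x. x \<noteq> 0 \<and> qform x = 0}"
      using Orb0 by (auto simp: d_def disc_def)
    have card0: "real (card {x::'a^3. x \<noteq> 0 \<and> qform x = 0}) = ?q^2 - 1" by (rule card_cone[OF odd])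
    have "{x::'a^3. x \<noteq> 0 \<and> qform x = 0} \<noteq> {}"
    proof
      assume empty: "{x::'a^3. x \<noteq> 0 \<and> qform x = 0} = {}"
      have "?q^2 = 1" using card0 unfolding empty by simp
      then show False using q by (simp add: power2_eq_1_iff)
    qed
    then have "\<P>(\<omega> in M. linearly_saturated 3 (\<lambda>i. K i \<omega>))
      = ((?q^2 - 1)^3 - (\<Sum>x\<in>{x::'a^3. x \<noteq> 0 \<and> qform x = 0}. \<Sum>y\<in>{x. x \<noteq> 0 \<and> qform x = 0}.
          \<Sum>z\<in>{x. x \<noteq> 0 \<and> qform x = 0}. of_bool (annihilator {x, y, z} \<noteq> {0}))) / (?q^2 - 1)^3"
      unfolding card0[symmetric] using nil cone by (intro prob_linearly_saturated[OF assms(7)]) simp_all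
    then show "\<P>(\<omega> in M. linearly_saturated 3 (\<lambda>i. K i \<omega>)) = real q * (real q - 1) / (real q + 1)^2"
      using linear_nilpotent_ratio[OF q dependent_triples_cone[OF odd]] assms(1) by simp
  qed
qed

end
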